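(* Let $\Gamma$ be a connected compact metric graph. Then the following Cheeger inequality holds: $$\frac14\,h(\Gamma)^2\le \mathrm{gap}(-\Delta_\Gamma),$$ where $h(\Gamma)$ is the $\Gamma$-Cheeger constant of $\Gamma$ and $\mathrm{gap}(-\Delta_\Gamma)$ is the smallest non-zero eigenvalue of the (Kirchhoff) Laplacian $-\Delta_\Gamma$ on $\Gamma$.
   Context: $\Gamma$ is a connected compact metric graph: it has finitely many vertices $V(\Gamma)$ and edges $E(\Gamma)$, no loops and no multiple edges; each edge $e$ is identified with an interval $[0,\ell_e]$, $0<\ell_e<\infty$, its initial vertex $i_e$ corresponding to $0$ and its terminal vertex $f_e$ to $\ell_e$. $E_v(\Gamma)$ is the set of edges incident to the vertex $v$. A function $u$ on $\Gamma$ is a collection of functions $[u]_e$ on $(0,\ell_e)$, $e\in E(\Gamma)$; $\int_\Gamma u\,dx=\sum_e\int_0^{\ell_e}[u]_e\,dx$. $L^p(\Gamma)$, $W^{k,p}(\Gamma)$, $BV(\Gamma)$ consist of the $u$ with $[u]_e$ in $L^p(0,\ell_e)$, $W^{k,p}(0,\ell_e)$, $BV(0,\ell_e)$ for every $e$ (no continuity at vertices is required); $u'$ is the edgewise weak derivative. For $A\subset\Gamma$ measurable, $\ell(A)=\int_\Gamma \chi_A\,dx$. For $z\in W^{1,2}(\Gamma)$ and $e\in E_v(\Gamma)$ put $[z]_e(v)=[z]_e(\ell_e)$ if $v=f_e$ and $[z]_e(v)=-[z]_e(0)$ if $v=i_e$. Let $X_K(\Gamma)=\{z\in W^{1,2}(\Gamma):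 \sum_{e\in E_v(\Gamma)}[z]_e(v)=0\ \forall v\in V(\Gamma)\}$. The total variation is $TV_\Gamma(u)=\sup\{|\int_\Gamma u z'\,dx| : z\in X_K(\Gamma),\ \|z\|_{L^\infty(\Gamma)}\le 1\}$ (value in $[0,+\infty]$ for $u\in L^1(\Gamma)$), and $\mathrm{Per}_\Gamma(E)=TV_\Gamma(\chi_E)$. The $\Gamma$-Cheeger constant of $\Gamma$ is $h(\Gamma)=\inf\{\mathrm{Per}_\Gamma(D)/\ell(D): D\subset\Gamma \text{ measurable},\ 0<\ell(D)\le\frac12\ell(\Gamma)\}$. The Laplacian $\Delta_\Gamma$ has domain $D(\Delta_\Gamma)$ consisting of the $u\in W^{2,2}(\Gamma)$ that are continuous on $\Gamma$ (in particular at the vertices) and satisfy $\sum_{e\in E_v(\Gamma)}\frac{\partial [u]_e}{\partial n_e}(v)=0$ for all $v\in V(\Gamma)$, where $\frac{\partial [u]_e}{\partial n_e}(v)=-[u]_e'(0+)$ if $v=i_e$ and $[u]_e'(\ell_e-)$ if $v=f_e$; it acts by $[\Delta_\Gamma u]_e=[u]_e''$. The operator $-\Delta_\Gamma$ is selfadjoint in $L^2(\Gamma)$, with energy form $\mathcal H_\Gamma(u)=\int_\Gamma (u')^2\,dx$ on the form domain $D(\mathcal H_\Gamma)=\{u\in W^{1,2}(\Gamma): u\text{ continuous at the vertices}\}$, and $$\mathrm{gap}(-\Delta_\Gamma)=\min\left\{\frac{\mathcal H_\Gamma(u)}{\|u\|_{L^2(\Gamma)}^2}: u\in D(\mathcal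 H_\Gamma),\ \|u\|_{L^2(\Gamma)}\ne0,\ \int_\Gamma u\,dx=0\right\}.$$ *)

theory Defs
  imports "HOL-Analysis.Analysis" "Graph_Theory.Digraph_Component"
begin

section \<open>Compact metric graphs\<close>

text \<open>The arc \<open>e\<close> is the interval \<open>[0, len e]\<close>, with \<open>tail G e\<close> at \<open>0\<close> (initial vertex)
  and \<open>head G e\<close> at \<open>len e\<close> (terminal vertex). The orientation is only this parametrisation:
  \<open>Digraph_Component.connected\<close> is connectedness of the underlying undirected graph, and multiple
  edges are excluded irrespective of their direction.\<close>

locale compact_metric_graph = fin_digraph G + loopfree_digraph G
  for G :: "('v, 'e) pre_digraph" +
  fixes len :: "'e \<Rightarrow> real"
  assumes connected_graph: "Digraph_Component.connected G"
    and no_multiple_edges: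
      "\<lbrakk>e \<in> arcs G; e' \<in> arcs G; {tail G e, head G e} = {tail G e', head G e'}\<rbrakk> \<Longrightarrow> e = e'"
    and len_pos: "e \<in> arcs G \<Longrightarrow> 0 < len e"

definition incident_edges :: "('v, 'e) pre_digraph \<Rightarrow> 'v \<Rightarrow> 'e set" where
  "incident_edges G v = {e \<in> arcs G. tail G e = v \<or> head G e = v}"

text \<open>A function on the graph is a family \<open>u :: 'e \<Rightarrow> real \<Rightarrow> real\<close>; only the values \<open>u e x\<close> with
  \<open>e \<in> arcs G\<close> and \<open>0 < x < len e\<close> matter (and the endpoint values, for continuous \<open>u e\<close>).\<close>

abbreviation edge_measure :: "real \<Rightarrow> real measure" where
  "edge_measure l \<equiv> lebesgue_on {0<..<l}"

definition graph_integral ::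
    "('v, 'e) pre_digraph \<Rightarrow> ('e \<Rightarrow> real) \<Rightarrow> ('e \<Rightarrow> real \<Rightarrow> real) \<Rightarrow> real" where
  "graph_integral G len u = (\<Sum>e\<in>arcs G. LINT x|edge_measure (len e). u e x)"

definition L2_norm ::
    "('v, 'e) pre_digraph \<Rightarrow> ('e \<Rightarrow> real) \<Rightarrow> ('e \<Rightarrow> real \<Rightarrow> real) \<Rightarrow> real" where
  "L2_norm G len u = sqrt (graph_integral G len (\<lambda>e x. (u e x)\<^sup>2))"


section \<open>Sobolev functions\<close>

definition square_integrable :: "real \<Rightarrow> (real \<Rightarrow> real) \<Rightarrow> bool" where
  "square_integrable l f \<longleftrightarrow>
     f \<in> borel_measurable (edge_measure l) \<and> integrable (edge_measure l) (\<lambda>x. (f x)\<^sup>2)"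

text \<open>Test functions are taken in \<open>C\<^sup>1\<close> with compact support in \<open>(0, l)\<close>, as in Brezis' textbook.\<close>

definition test_function :: "real \<Rightarrow> (real \<Rightarrow> real) \<Rightarrow> bool" where
  "test_function l \<phi> \<longleftrightarrow>
     \<phi> C1_differentiable_on UNIV \<and> (\<exists>K. compact K \<and> K \<subseteq> {0<..<l} \<and> (\<forall>x. x \<notin> K \<longrightarrow> \<phi> x = 0))"

definition has_weak_deriv :: "real \<Rightarrow> (real \<Rightarrow> real) \<Rightarrow> (real \<Rightarrow> real) \<Rightarrow> bool" where
  "has_weak_deriv l f g \<longleftrightarrow>
     (\<forall>\<phi>. test_function l \<phi> \<longrightarrow>
        (LINT x|edge_measure l. f x * deriv \<phi> x) = - (LINT x|edge_measure l. g x * \<phi> x))"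

definition W12_interval :: "real \<Rightarrow> (real \<Rightarrow> real) set" where
  "W12_interval l =
     {f. square_integrable l f \<and> (\<exists>g. square_integrable l g \<and> has_weak_deriv l f g)}"

text \<open>The weak derivative of \<open>f \<in> W12_interval l\<close> is determined up to null sets only.\<close>

definition weak_deriv :: "real \<Rightarrow> (real \<Rightarrow> real) \<Rightarrow> real \<Rightarrow> real" where
  "weak_deriv l f = (SOME g. square_integrable l g \<and> has_weak_deriv l f g)"

definition edge_deriv :: "('e \<Rightarrow> real) \<Rightarrow> ('e \<Rightarrow> real \<Rightarrow> real) \<Rightarrow> 'e \<Rightarrow> real \<Rightarrow> real" where
  "edge_deriv len u e = weak_deriv (len e) (u e)"

text \<open>Elements of \<open>W\<^sup>1\<^sup>,\<^sup>2\<close> of the graph are represented by the representative that is continuous on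
  each closed edge, so that the endpoint values \<open>u e 0\<close> and \<open>u e (len e)\<close> make sense.\<close>

definition W12 :: "('v, 'e) pre_digraph \<Rightarrow> ('e \<Rightarrow> real) \<Rightarrow> ('e \<Rightarrow> real \<Rightarrow> real) set" where
  "W12 G len =
     {u. \<forall>e\<in>arcs G. u e \<in> W12_interval (len e) \<and> continuous_on {0..len e} (u e)}"

definition W22 :: "('v, 'e) pre_digraph \<Rightarrow> ('e \<Rightarrow> real) \<Rightarrow> ('e \<Rightarrow> real \<Rightarrow> real) set" where
  "W22 G len = {u \<in> W12 G len. \<forall>e\<in>arcs G. edge_deriv len u e \<in> W12_interval (len e)}"

definition vertex_value ::
    "('v, 'e) pre_digraph \<Rightarrow> ('e \<Rightarrow> real) \<Rightarrow> ('e \<Rightarrow> real \<Rightarrow> real) \<Rightarrow> 'e \<Rightarrow> 'v \<Rightarrow> real" where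
  "vertex_value G len u e v = (if v = head G e then u e (len e) else u e 0)"

definition continuous_at_vertices ::
    "('v, 'e) pre_digraph \<Rightarrow> ('e \<Rightarrow> real) \<Rightarrow> ('e \<Rightarrow> real \<Rightarrow> real) \<Rightarrow> bool" where
  "continuous_at_vertices G len u \<longleftrightarrow>
     (\<forall>v\<in>verts G. \<forall>e\<in>incident_edges G v. \<forall>e'\<in>incident_edges G v.
        vertex_value G len u e v = vertex_value G len u e' v)"


section \<open>Total variation, perimeter and Cheeger constant\<close>

definition signed_vertex_value ::
    "('v, 'e) pre_digraph \<Rightarrow> ('e \<Rightarrow> real) \<Rightarrow> ('e \<Rightarrow> real \<Rightarrow> real) \<Rightarrow> 'e \<Rightarrow> 'v \<Rightarrow> real" where
  "signed_vertex_value G len z e v = (if v = head G e then z e (len e) else - z e 0)"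

definition X_K :: "('v, 'e) pre_digraph \<Rightarrow> ('e \<Rightarrow> real) \<Rightarrow> ('e \<Rightarrow> real \<Rightarrow> real) set" where
  "X_K G len =
     {z \<in> W12 G len. \<forall>v\<in>verts G. (\<Sum>e\<in>incident_edges G v. signed_vertex_value G len z e v) = 0}"

definition Linf_norm_le_1 ::
    "('v, 'e) pre_digraph \<Rightarrow> ('e \<Rightarrow> real) \<Rightarrow> ('e \<Rightarrow> real \<Rightarrow> real) \<Rightarrow> bool" where
  "Linf_norm_le_1 G len z \<longleftrightarrow> (\<forall>e\<in>arcs G. AE x in edge_measure (len e). \<bar>z e x\<bar> \<le> 1)"

text \<open>Used below for bounded \<open>u\<close> only, so that all the integrands are integrable.\<close>

definition total_variation ::
    "('v, 'e) pre_digraph \<Rightarrow> ('e \<Rightarrow> real) \<Rightarrow> ('e \<Rightarrow> real \<Rightarrow> real) \<Rightarrow> ereal" where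
  "total_variation G len u =
     (SUP z \<in> {z \<in> X_K G len. Linf_norm_le_1 G len z}.
        ereal \<bar>graph_integral G len (\<lambda>e x. u e x * edge_deriv len z e x)\<bar>)"

text \<open>A measurable subset of the graph is given, up to the null set of vertices, by its traces on
  the open edges.\<close>

definition measurable_subset ::
    "('v, 'e) pre_digraph \<Rightarrow> ('e \<Rightarrow> real) \<Rightarrow> ('e \<Rightarrow> real set) \<Rightarrow> bool" where
  "measurable_subset G len D \<longleftrightarrow> (\<forall>e\<in>arcs G. D e \<in> sets (edge_measure (len e)))"

definition graph_length ::
    "('v, 'e) pre_digraph \<Rightarrow> ('e \<Rightarrow> real) \<Rightarrow> ('e \<Rightarrow> real set) \<Rightarrow> real" where
  "graph_length G len D = graph_integral G len (\<lambda>e. indicator (D e))"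

definition whole_graph :: "('e \<Rightarrow> real) \<Rightarrow> 'e \<Rightarrow> real set" where
  "whole_graph len e = {0<..<len e}"

definition perimeter ::
    "('v, 'e) pre_digraph \<Rightarrow> ('e \<Rightarrow> real) \<Rightarrow> ('e \<Rightarrow> real set) \<Rightarrow> ereal" where
  "perimeter G len D = total_variation G len (\<lambda>e. indicator (D e))"

definition cheeger_constant :: "('v, 'e) pre_digraph \<Rightarrow> ('e \<Rightarrow> real) \<Rightarrow> ereal" where
  "cheeger_constant G len =
     (INF D \<in> {D. measurable_subset G len D \<and> 0 < graph_length G len D \<and>
                 graph_length G len D \<le> 1/2 * graph_length G len (whole_graph len)}.
        perimeter G len D / ereal (graph_length G len D))"


section \<open>Kirchhoff Laplacian\<close>

text \<open>For \<open>u \<in> W22 G len\<close> the (continuous) function \<open>u e\<close> is \<open>C\<^sup>1\<close> up to the endpoints, so the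
  one-sided limits of its classical derivative exist.\<close>

definition normal_deriv ::
    "('v, 'e) pre_digraph \<Rightarrow> ('e \<Rightarrow> real) \<Rightarrow> ('e \<Rightarrow> real \<Rightarrow> real) \<Rightarrow> 'e \<Rightarrow> 'v \<Rightarrow> real" where
  "normal_deriv G len u e v =
     (if v = head G e then Lim (at_left (len e)) (deriv (u e))
      else - Lim (at_right 0) (deriv (u e)))"

definition laplacian_domain ::
    "('v, 'e) pre_digraph \<Rightarrow> ('e \<Rightarrow> real) \<Rightarrow> ('e \<Rightarrow> real \<Rightarrow> real) set" where
  "laplacian_domain G len =
     {u \<in> W22 G len. continuous_at_vertices G len u \<and>
        (\<forall>v\<in>verts G. (\<Sum>e\<in>incident_edges G v. normal_deriv G len u e v) = 0)}"

definition laplacian :: "('e \<Rightarrow> real) \<Rightarrow> ('e \<Rightarrow> real \<Rightarrow> real) \<Rightarrow> 'e \<Rightarrow> real \<Rightarrow> real" where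
  "laplacian len u = edge_deriv len (edge_deriv len u)"

text \<open>Eigenvalues of the negative Laplacian. Being selfadjoint and commuting with complex
  conjugation, it has only real eigenvalues, with real eigenfunctions.\<close>

definition neg_laplacian_eigenvalue ::
    "('v, 'e) pre_digraph \<Rightarrow> ('e \<Rightarrow> real) \<Rightarrow> real \<Rightarrow> bool" where
  "neg_laplacian_eigenvalue G len \<mu> \<longleftrightarrow>
     (\<exists>u \<in> laplacian_domain G len. L2_norm G len u \<noteq> 0 \<and>
        (\<forall>e\<in>arcs G. AE x in edge_measure (len e). - laplacian len u e x = \<mu> * u e x))"

definition energy_domain ::
    "('v, 'e) pre_digraph \<Rightarrow> ('e \<Rightarrow> real) \<Rightarrow> ('e \<Rightarrow> real \<Rightarrow> real) set" where
  "energy_domain G len = {u \<in> W12 G len. continuous_at_vertices G len u}"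

definition energy ::
    "('v, 'e) pre_digraph \<Rightarrow> ('e \<Rightarrow> real) \<Rightarrow> ('e \<Rightarrow> real \<Rightarrow> real) \<Rightarrow> real" where
  "energy G len u = graph_integral G len (\<lambda>e x. (edge_deriv len u e x)\<^sup>2)"

definition spectral_gap :: "('v, 'e) pre_digraph \<Rightarrow> ('e \<Rightarrow> real) \<Rightarrow> ereal" where
  "spectral_gap G len =
     (INF u \<in> {u \<in> energy_domain G len. L2_norm G len u \<noteq> 0 \<and> graph_integral G len u = 0}.
        ereal (energy G len u / (L2_norm G len u)\<^sup>2))"

end

(* Subdivide every edge into n equal steps and give each node the half-steps around it as its
   cell. By the Kirchhoff condition on the test fields and summation by parts, a union of cells
   that is consistent at the vertices has perimeter at most the number of neighbouring nodes that
   it separates. The definition of the Cheeger constant thus yields an isoperimetric inequality on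
   the nodes, and the classical argument (median, coarea formula for the squared positive and
   negative parts, Cauchy-Schwarz) gives a discrete Cheeger inequality with the constant 1/4.
   The discrete Dirichlet energy never exceeds the energy of u, and the remaining sums are
   Riemann sums, so n \<longrightarrow> \<infinity> finishes the bound for the spectral gap.
   For a nonzero eigenvalue \<mu> a du Bois-Reymond argument shows that the eigenfunction is classical;
   integration by parts then gives mean zero and energy \<mu> times the squared norm. *)

theory Submission
  imports Defs
begin

section \<open>A discrete Cheeger inequality\<close>

text \<open>Discretising means that only finite unions of intervals are inserted into the Cheeger
  constant, and for these the pairing with \<open>edge_deriv len z\<close> is a finite sum of point
  values of \<open>z\<close>. The cuts lie midway between nodes, so a vertex is never a jump point:
  all its edges end in cells with the same membership, and the values of \<open>z\<close> there
  cancel. A vertex is represented by one node per incident edge; level sets of the node values treat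
  these copies alike, so the isoperimetric hypothesis is stated for such sets only. A median is
  subtracted instead of the mean, because the level sets on either side must have at most half of
  the length. Cells of half-steps make the weighted node sums exact trapezoidal sums, so the
  discrete inequality already has the constant 1/4, without any error term. The mean of
  \<open>u\<close> on the grid vanishes only in the limit, hence the weighted variance in the
  discrete inequality. The Cheeger constant can be infinite, for instance without edges, so the
  argument runs over the real numbers \<open>h\<close> that do not exceed it.\<close>

lemma has_integral_threshold:
  fixes A M :: real
  assumes "0 \<le> A" "A \<le> M"
  shows "((\<lambda>s. of_bool (s < A) :: real) has_integral A) {0..M}"
proof -
  have "((\<lambda>s. of_bool (s < A) :: real) has_integral A) {0..A}"
  proof (rule has_integral_spike_finite[of "{A}"])
    show "((\<lambda>s. 1 :: real) has_integral A) {0..A}"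
      using has_integral_const_real[of "1::real" 0 A] assms by simp
  qed auto
  moreover have "((\<lambda>s. of_bool (s < A) :: real) has_integral 0) {A..M}"
    by (rule has_integral_eq[of _ "\<lambda>s. 0"]) auto
  ultimately show ?thesis
    using has_integral_combine[of 0 A M "\<lambda>s. of_bool (s < A) :: real" A 0] assms by simp
qed

lemma has_integral_threshold_diff:
  fixes A B M :: real
  assumes "0 \<le> A" "A \<le> M" "0 \<le> B" "B \<le> M"
  shows "((\<lambda>s. \<bar>of_bool (s < A) - of_bool (s < B)\<bar> :: real) has_integral \<bar>A - B\<bar>) {0..M}"
proof -
  have "((\<lambda>s. of_bool (s < max A B) - of_bool (s < min A B) :: real)
      has_integral (max A B - min A B)) {0..M}"
    using assms by (intro has_integral_diff has_integral_threshold) auto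
  moreover have "max A B - min A B = \<bar>A - B\<bar>" by linarith
  moreover have "of_bool (s < max A B) - of_bool (s < min A B)
      = (\<bar>of_bool (s < A) - of_bool (s < B)\<bar> :: real)" for s by auto
  ultimately show ?thesis by simp
qed

text \<open>By the layer-cake formula both sides are integrals over a level \<open>s\<close> of
  threshold functions of the squares, so it suffices to compare the integrands. The set
  \<open>s < (y i)\<^sup>2\<close> is the level set of \<open>y\<close> at \<open>sqrt s\<close>,
  where \<open>iso\<close> applies.\<close>

lemma discrete_coarea:
  fixes w y :: "'i \<Rightarrow> real" and p q :: "'b \<Rightarrow> 'i" and h :: real
  assumes "finite I" "finite B"
    and p: "\<And>b. b \<in> B \<Longrightarrow> p b \<in> I" and q: "\<And>b. b \<in> B \<Longrightarrow> q b \<in> I"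
    and y: "\<And>i. i \<in> I \<Longrightarrow> 0 \<le> y i"
    and iso: "\<And>t. 0 \<le> t \<Longrightarrow> h * (\<Sum>i\<in>I. w i * of_bool (t < y i))
      \<le> (\<Sum>b\<in>B. \<bar>of_bool (t < y (p b)) - of_bool (t < y (q b))\<bar>)"
  shows "h * (\<Sum>i\<in>I. w i * (y i)\<^sup>2) \<le> (\<Sum>b\<in>B. \<bar>(y (p b))\<^sup>2 - (y (q b))\<^sup>2\<bar>)"
proof -
  \<comment> \<open>One compact range of levels serves all nodes once it covers every square; the
    sum also makes sense for empty \<open>I\<close>.\<close>
  define M where "M = (\<Sum>i\<in>I. (y i)\<^sup>2)"
  have M: "(y i)\<^sup>2 \<le> M" if "i \<in> I" for i
    unfolding M_def using assms(1) that by (intro member_le_sum) auto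
  have "((\<lambda>s. h * (\<Sum>i\<in>I. w i * of_bool (s < (y i)\<^sup>2))) has_integral
      h * (\<Sum>i\<in>I. w i * (y i)\<^sup>2)) {0..M}"
    using assms(1) M by (intro has_integral_mult_right has_integral_sum has_integral_threshold) auto
  moreover have "((\<lambda>s. \<Sum>b\<in>B. \<bar>of_bool (s < (y (p b))\<^sup>2) - of_bool (s < (y (q b))\<^sup>2)\<bar>) has_integral
      (\<Sum>b\<in>B. \<bar>(y (p b))\<^sup>2 - (y (q b))\<^sup>2\<bar>)) {0..M}"
    using assms(2) M p q by (intro has_integral_sum has_integral_threshold_diff) auto
  ultimately show ?thesis
  proof (rule has_integral_le)
    fix s :: real assume "s \<in> {0..M}"
    then have s: "0 \<le> s" by simp
    have eq: "s < (y i)\<^sup>2 \<longleftrightarrow> sqrt s < y i" if "i \<in> I" for i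
      using y[OF that] s by (metis abs_of_nonneg real_sqrt_abs real_sqrt_less_iff)
    have "(\<Sum>i\<in>I. w i * of_bool (s < (y i)\<^sup>2)) = (\<Sum>i\<in>I. w i * of_bool (sqrt s < y i))"
      by (intro sum.cong) (simp_all add: eq)
    moreover have "(\<Sum>b\<in>B. \<bar>of_bool (s < (y (p b))\<^sup>2) - of_bool (s < (y (q b))\<^sup>2)\<bar> :: real)
        = (\<Sum>b\<in>B. \<bar>of_bool (sqrt s < y (p b)) - of_bool (sqrt s < y (q b))\<bar>)"
      by (intro sum.cong) (simp_all add: eq p q)
    ultimately show "h * (\<Sum>i\<in>I. w i * of_bool (s < (y i)\<^sup>2))
        \<le> (\<Sum>b\<in>B. \<bar>of_bool (s < (y (p b))\<^sup>2) - of_bool (s < (y (q b))\<^sup>2)\<bar>)"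
      using iso[of "sqrt s"] s by simp
  qed
qed

text \<open>Coarea bounds \<open>h * ?S\<close> by differences of squares. Young's inequality splits
  these into an energy part and a mass part; hypothesis \<open>w\<close> turns the mass part back
  into \<open>?S\<close>, which is then absorbed on the left.\<close>

lemma discrete_cheeger_nonneg:
  fixes w y :: "'i \<Rightarrow> real" and \<delta> :: "'b \<Rightarrow> real" and h :: real
  assumes "finite I" "finite B"
    and p: "\<And>b. b \<in> B \<Longrightarrow> p b \<in> I" and q: "\<And>b. b \<in> B \<Longrightarrow> q b \<in> I"
    and \<delta>: "\<And>b. b \<in> B \<Longrightarrow> 0 < \<delta> b"
    and w: "(\<Sum>b\<in>B. \<delta> b * ((y (p b))\<^sup>2 + (y (q b))\<^sup>2)) \<le> 2 * (\<Sum>i\<in>I. w i * (y i)\<^sup>2)"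
    and y: "\<And>i. i \<in> I \<Longrightarrow> 0 \<le> y i"
    and h: "0 \<le> h"
    and iso: "\<And>t. 0 \<le> t \<Longrightarrow> h * (\<Sum>i\<in>I. w i * of_bool (t < y i))
      \<le> (\<Sum>b\<in>B. \<bar>of_bool (t < y (p b)) - of_bool (t < y (q b))\<bar>)"
  shows "h\<^sup>2 * (\<Sum>i\<in>I. w i * (y i)\<^sup>2) \<le> 4 * (\<Sum>b\<in>B. (y (p b) - y (q b))\<^sup>2 / \<delta> b)"
proof (cases "h = 0")
  case True
  have "0 \<le> (\<Sum>b\<in>B. (y (p b) - y (q b))\<^sup>2 / \<delta> b)"
    using \<delta> by (intro sum_nonneg divide_nonneg_pos) auto
  then show ?thesis using True by simp
next
  case False
  with h have h: "0 < h" by simp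
  let ?S = "\<Sum>i\<in>I. w i * (y i)\<^sup>2"
  let ?E = "\<Sum>b\<in>B. (y (p b) - y (q b))\<^sup>2 / \<delta> b"
  have young: "\<bar>(y (p b))\<^sup>2 - (y (q b))\<^sup>2\<bar> \<le> 2 / h * ((y (p b) - y (q b))\<^sup>2 / \<delta> b)
      + h / 4 * (\<delta> b * ((y (p b))\<^sup>2 + (y (q b))\<^sup>2))" if "b \<in> B" for b
  proof -
    define r s d where "r = y (p b)" and "s = y (q b)" and "d = \<delta> b"
    have d: "0 < d" using \<delta>[OF that] by (simp add: d_def)
    \<comment> \<open>The weights 4 and \<open>h * d\<close> are chosen so that, after division by
      \<open>8 * (h * d)\<close>, the mass term carries \<open>h / 4\<close>. By \<open>w\<close> it
      sums to at most \<open>h / 2 * ?S\<close>, half of the left side.\<close>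
    have "(4 * \<bar>r - s\<bar> - h * d * \<bar>r + s\<bar>)\<^sup>2 \<ge> 0" by simp
    then have "8 * (h * d) * (\<bar>r - s\<bar> * \<bar>r + s\<bar>) \<le> 16 * (r - s)\<^sup>2 + (h * d)\<^sup>2 * (r + s)\<^sup>2"
      by (simp add: power2_diff power_mult_distrib algebra_simps)
    also have "(h * d)\<^sup>2 * (r + s)\<^sup>2 \<le> (h * d)\<^sup>2 * (2 * (r\<^sup>2 + s\<^sup>2))"
      using sum_squares_bound[of r s] by (intro mult_left_mono) (auto simp: power2_sum)
    finally have "8 * (h * d) * \<bar>r\<^sup>2 - s\<^sup>2\<bar> \<le> 16 * (r - s)\<^sup>2 + (h * d)\<^sup>2 * (2 * (r\<^sup>2 + s\<^sup>2))"
      by (simp add: abs_mult[symmetric] power2_eq_square algebra_simps)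
    then have "\<bar>r\<^sup>2 - s\<^sup>2\<bar> \<le> (16 * (r - s)\<^sup>2 + (h * d)\<^sup>2 * (2 * (r\<^sup>2 + s\<^sup>2))) / (8 * (h * d))"
      using h d by (simp add: pos_le_divide_eq mult.commute)
    also have "\<dots> = 2 / h * ((r - s)\<^sup>2 / d) + h / 4 * (d * (r\<^sup>2 + s\<^sup>2))"
      using h d by (simp add: field_simps power2_eq_square)
    finally show ?thesis by (simp add: r_def s_def d_def)
  qed
  have "h * ?S \<le> (\<Sum>b\<in>B. \<bar>(y (p b))\<^sup>2 - (y (q b))\<^sup>2\<bar>)"
    by (rule discrete_coarea) (use assms in auto)
  also have "\<dots> \<le> (\<Sum>b\<in>B. 2 / h * ((y (p b) - y (q b))\<^sup>2 / \<delta> b)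
      + h / 4 * (\<delta> b * ((y (p b))\<^sup>2 + (y (q b))\<^sup>2)))"
    by (intro sum_mono young)
  also have "\<dots> = 2 / h * ?E + h / 4 * (\<Sum>b\<in>B. \<delta> b * ((y (p b))\<^sup>2 + (y (q b))\<^sup>2))"
    by (simp add: sum.distrib sum_distrib_left)
  also have "\<dots> \<le> 2 / h * ?E + h / 4 * (2 * ?S)"
    using w h by (intro add_left_mono mult_left_mono) auto
  finally have "h * ?S \<le> 4 / h * ?E" using h by (simp add: field_simps)
  then have "h * (h * ?S) \<le> h * (4 / h * ?E)" using h by (intro mult_left_mono) auto
  then show ?thesis using h by (simp add: power2_eq_square mult.assoc)
qed

text \<open>The median is the least value whose cumulative weight reaches half of the total: at most
  the other half lies above it, and the cumulative weight at the next smaller value stays below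
  half.\<close>

lemma weighted_median_exists:
  fixes w x :: "'i \<Rightarrow> real"
  assumes "finite I" and w: "\<And>i. i \<in> I \<Longrightarrow> 0 \<le> w i"
  obtains c where "(\<Sum>i\<in>I. w i * of_bool (c < x i)) \<le> (\<Sum>i\<in>I. w i) / 2"
    and "(\<Sum>i\<in>I. w i * of_bool (x i < c)) \<le> (\<Sum>i\<in>I. w i) / 2"
proof (cases "I = {}")
  case True
  then show ?thesis using that[of 0] by simp
next
  case False
  let ?W = "\<Sum>i\<in>I. w i"
  let ?F = "\<lambda>t. \<Sum>i\<in>I. w i * of_bool (x i \<le> t)"
  have W: "0 \<le> ?W" using w by (simp add: sum_nonneg)
  have compl: "(\<Sum>i\<in>I. w i * of_bool (t < x i)) = ?W - ?F t" for t
    unfolding sum_subtractf[symmetric] by (intro sum.cong) auto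
  define T where "T = {t \<in> x ` I. ?W / 2 \<le> ?F t}"
  have "?F (Max (x ` I)) = ?W"
    using assms(1) by (intro sum.cong) auto
  then have "?W / 2 \<le> ?F (Max (x ` I))" using W by linarith
  moreover have "Max (x ` I) \<in> x ` I" using assms(1) False by simp
  ultimately have "Max (x ` I) \<in> T" unfolding T_def by blast
  then have T: "finite T" "T \<noteq> {}" using assms(1) by (auto simp: T_def)
  define c where "c = Min T"
  have c: "c \<in> T" unfolding c_def using T by simp
  have "(\<Sum>i\<in>I. w i * of_bool (x i < c)) \<le> ?W / 2"
  proof (rule ccontr)
    assume *: "\<not> ?thesis"
    \<comment> \<open>\<open>Max L\<close> is the value just below \<open>c\<close>, so lying
      strictly below \<open>c\<close> means lying at or below \<open>Max L\<close>.\<close>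
    define L where "L = {t \<in> x ` I. t < c}"
    have "finite L" using assms(1) by (simp add: L_def)
    moreover have "L \<noteq> {}"
    proof
      assume "L = {}"
      then have "(\<Sum>i\<in>I. w i * of_bool (x i < c)) = 0" by (intro sum.neutral) (auto simp: L_def)
      with * W show False by simp
    qed
    ultimately have L: "Max L \<in> L" "\<And>t. t \<in> L \<Longrightarrow> t \<le> Max L" by auto
    have "?F (Max L) = (\<Sum>i\<in>I. w i * of_bool (x i < c))"
      using L by (intro sum.cong) (fastforce simp: L_def)+
    with * have "Max L \<in> T" using L(1) by (simp add: T_def L_def)
    then have "c \<le> Max L" unfolding c_def using T by simp
    with L(1) show False by (simp add: L_def)
  qed
  with c that[of c] show ?thesis by (simp add: compl T_def)
qed

text \<open>Splitting at a median \<open>c\<close> gives two nonnegative functions whose level sets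
  have at most half of the weight, as \<open>iso\<close> requires. Since \<open>iso\<close> speaks
  of predicates on the value \<open>x i\<close>, nodes with equal values are never separated. The
  weighted variance on the left allows for a nonzero mean.\<close>

lemma discrete_cheeger:
  fixes w x :: "'i \<Rightarrow> real" and \<delta> :: "'b \<Rightarrow> real" and h :: real
  assumes "finite I" "finite B"
    and p: "\<And>b. b \<in> B \<Longrightarrow> p b \<in> I" and q: "\<And>b. b \<in> B \<Longrightarrow> q b \<in> I"
    and \<delta>: "\<And>b. b \<in> B \<Longrightarrow> 0 < \<delta> b"
    and w: "\<And>i. i \<in> I \<Longrightarrow> 0 \<le> w i"
    and w\<delta>: "\<And>f :: 'i \<Rightarrow> real. (\<Sum>b\<in>B. \<delta> b * (f (p b) + f (q b))) = 2 * (\<Sum>i\<in>I. w i * f i)"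
    and W: "0 < (\<Sum>i\<in>I. w i)"
    and h: "0 \<le> h"
    and iso: "\<And>\<phi> :: real \<Rightarrow> bool. (\<Sum>i\<in>I. w i * of_bool (\<phi> (x i))) \<le> (\<Sum>i\<in>I. w i) / 2 \<Longrightarrow>
      h * (\<Sum>i\<in>I. w i * of_bool (\<phi> (x i)))
        \<le> (\<Sum>b\<in>B. \<bar>of_bool (\<phi> (x (p b))) - of_bool (\<phi> (x (q b)))\<bar>)"
  shows "h\<^sup>2 * ((\<Sum>i\<in>I. w i * (x i)\<^sup>2) - (\<Sum>i\<in>I. w i * x i)\<^sup>2 / (\<Sum>i\<in>I. w i))
    \<le> 4 * (\<Sum>b\<in>B. (x (p b) - x (q b))\<^sup>2 / \<delta> b)"
proof -
  obtain c where c: "(\<Sum>i\<in>I. w i * of_bool (c < x i)) \<le> (\<Sum>i\<in>I. w i) / 2"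
      "(\<Sum>i\<in>I. w i * of_bool (x i < c)) \<le> (\<Sum>i\<in>I. w i) / 2"
    by (rule weighted_median_exists[OF assms(1) w])
  define y z where "y i = max 0 (x i - c)" and "z i = max 0 (c - x i)" for i
  have sub: "(\<Sum>i\<in>I. w i * of_bool (\<phi> (x i))) \<le> (\<Sum>i\<in>I. w i) / 2"
    if "\<And>r. \<phi> r \<Longrightarrow> \<psi> r" "(\<Sum>i\<in>I. w i * of_bool (\<psi> (x i))) \<le> (\<Sum>i\<in>I. w i) / 2" for \<phi> \<psi> :: "real \<Rightarrow> bool"
    using that w by (intro order_trans[OF sum_mono that(2)] mult_left_mono) auto
  have "h\<^sup>2 * (\<Sum>i\<in>I. w i * (y i)\<^sup>2) \<le> 4 * (\<Sum>b\<in>B. (y (p b) - y (q b))\<^sup>2 / \<delta> b)"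
  proof (rule discrete_cheeger_nonneg)
    fix t :: real assume t: "0 \<le> t"
    have eq: "t < y i \<longleftrightarrow> c + t < x i" for i using t by (auto simp: y_def)
    show "h * (\<Sum>i\<in>I. w i * of_bool (t < y i))
      \<le> (\<Sum>b\<in>B. \<bar>of_bool (t < y (p b)) - of_bool (t < y (q b))\<bar>)"
      unfolding eq using t by (intro iso sub[OF _ c(1)]) auto
  qed (use assms w\<delta>[of "\<lambda>i. (y i)\<^sup>2"] in \<open>auto simp: y_def\<close>)
  moreover have "h\<^sup>2 * (\<Sum>i\<in>I. w i * (z i)\<^sup>2) \<le> 4 * (\<Sum>b\<in>B. (z (p b) - z (q b))\<^sup>2 / \<delta> b)"
  proof (rule discrete_cheeger_nonneg)
    fix t :: real assume t: "0 \<le> t"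
    have eq: "t < z i \<longleftrightarrow> x i < c - t" for i using t by (auto simp: z_def)
    show "h * (\<Sum>i\<in>I. w i * of_bool (t < z i))
      \<le> (\<Sum>b\<in>B. \<bar>of_bool (t < z (p b)) - of_bool (t < z (q b))\<bar>)"
      unfolding eq using t by (intro iso[of "\<lambda>r. r < c - t"] sub[OF _ c(2)]) auto
  qed (use assms w\<delta>[of "\<lambda>i. (z i)\<^sup>2"] in \<open>auto simp: z_def\<close>)
  moreover have "(\<Sum>b\<in>B. (y (p b) - y (q b))\<^sup>2 / \<delta> b) + (\<Sum>b\<in>B. (z (p b) - z (q b))\<^sup>2 / \<delta> b)
      \<le> (\<Sum>b\<in>B. (x (p b) - x (q b))\<^sup>2 / \<delta> b)"
  proof -
    \<comment> \<open>As functions of \<open>x\<close>, \<open>y\<close> is nondecreasing and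
      \<open>z\<close> nonincreasing, so the product of their increments is at most 0 and the mixed
      term has the favourable sign.\<close>
    have "(y i - y j)\<^sup>2 + (z i - z j)\<^sup>2 \<le> (x i - x j)\<^sup>2" for i j
    proof -
      have "x i - x j = (y i - y j) - (z i - z j)" by (auto simp: y_def z_def)
      moreover have "(y i - y j) * (z i - z j) \<le> 0"
        by (auto simp: y_def z_def max_def mult_le_0_iff)
      moreover have "(r - s)\<^sup>2 = r\<^sup>2 + s\<^sup>2 - 2 * (r * s)" for r s :: real
        by (simp add: power2_diff)
      ultimately show ?thesis by simp
    qed
    then show ?thesis
      unfolding sum.distrib[symmetric] add_divide_distrib[symmetric]
      using \<delta> by (intro sum_mono divide_right_mono) (auto simp: less_imp_le)
  qed
  moreover have "(\<Sum>i\<in>I. w i * (x i)\<^sup>2) - (\<Sum>i\<in>I. w i * x i)\<^sup>2 / (\<Sum>i\<in>I. w i)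
      \<le> (\<Sum>i\<in>I. w i * (y i)\<^sup>2) + (\<Sum>i\<in>I. w i * (z i)\<^sup>2)"
  proof -
    define S W where "S = (\<Sum>i\<in>I. w i * x i)" and "W = (\<Sum>i\<in>I. w i)"
    have "(\<Sum>i\<in>I. w i * (y i)\<^sup>2) + (\<Sum>i\<in>I. w i * (z i)\<^sup>2) = (\<Sum>i\<in>I. w i * (x i - c)\<^sup>2)"
      unfolding sum.distrib[symmetric]
      by (intro sum.cong) (auto simp: y_def z_def max_def power2_eq_square algebra_simps)
    also have "\<dots> = (\<Sum>i\<in>I. w i * (x i)\<^sup>2) - 2 * c * S + c\<^sup>2 * W"
      by (simp add: S_def W_def power2_diff algebra_simps sum.distrib sum_subtractf sum_distrib_left sum_distrib_right)
    finally have "(\<Sum>i\<in>I. w i * (y i)\<^sup>2) + (\<Sum>i\<in>I. w i * (z i)\<^sup>2)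
      = (\<Sum>i\<in>I. w i * (x i)\<^sup>2) - 2 * c * S + c\<^sup>2 * W" .
    \<comment> \<open>The mean minimises the weighted squared distance, so the squared distance from
      \<open>c\<close> is at least the variance; the excess is this square.\<close>
    moreover have "S\<^sup>2 / W - 2 * c * S + c\<^sup>2 * W = (S - c * W)\<^sup>2 / W"
      using W by (simp add: W_def[symmetric] field_simps power2_eq_square)
    moreover have "(S - c * W)\<^sup>2 / W \<ge> 0" using W by (simp add: W_def[symmetric])
    ultimately show ?thesis unfolding S_def[symmetric] W_def[symmetric] by linarith
  qed
  then have "h\<^sup>2 * ((\<Sum>i\<in>I. w i * (x i)\<^sup>2) - (\<Sum>i\<in>I. w i * x i)\<^sup>2 / (\<Sum>i\<in>I. w i))
      \<le> h\<^sup>2 * ((\<Sum>i\<in>I. w i * (y i)\<^sup>2) + (\<Sum>i\<in>I. w i * (z i)\<^sup>2))"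
    by (intro mult_left_mono) auto
  ultimately show ?thesis by (simp add: distrib_left)
qed

section \<open>Weak derivatives on an interval\<close>

lemma edge_integrable_iff:
  fixes f :: "real \<Rightarrow> real"
  shows "integrable (edge_measure l) f \<longleftrightarrow> f absolutely_integrable_on {0..l}"
proof -
  have "integrable (edge_measure l) f \<longleftrightarrow> f absolutely_integrable_on {0<..<l}"
    by (simp add: set_integrable_def integrable_restrict_space)
  also have "\<dots> \<longleftrightarrow> f absolutely_integrable_on {0..l}"
    using absolutely_integrable_on_open_interval[where f = f and a = 0 and b = l] by simp
  finally show ?thesis .
qed

lemma edge_integral_eq:
  fixes f :: "real \<Rightarrow> real"
  assumes "integrable (edge_measure l) f"
  shows "(LINT x|edge_measure l. f x) = integral {0..l} f"
  using lebesgue_integral_eq_integral[OF assms] by (simp add: integral_open_interval_real)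

lemma edge_integrable_continuous:
  fixes f :: "real \<Rightarrow> real"
  assumes "continuous_on {0..l} f"
  shows "integrable (edge_measure l) f"
  unfolding edge_integrable_iff by (rule absolutely_integrable_continuous_real[OF assms])

lemma square_integrable_imp_integrable:
  assumes "square_integrable l f"
  shows "integrable (edge_measure l) f"
proof (rule Bochner_Integration.integrable_bound)
  have "integrable (edge_measure l) (\<lambda>x. 1 :: real)"
    by (rule edge_integrable_continuous) simp
  then show "integrable (edge_measure l) (\<lambda>x. 1 + (f x)\<^sup>2)"
    using assms by (intro Bochner_Integration.integrable_add) (auto simp: square_integrable_def)
  show "f \<in> borel_measurable (edge_measure l)" using assms by (simp add: square_integrable_def)
  have "\<bar>r\<bar> \<le> \<bar>1 + r\<^sup>2\<bar>" for r :: real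
    using sum_squares_bound[of "\<bar>r\<bar>" 1] by simp
  then show "AE x in edge_measure l. norm (f x) \<le> norm (1 + (f x)\<^sup>2)" by simp
qed

lemma square_integrable_continuous:
  assumes "continuous_on {0..l} f"
  shows "square_integrable l f"
proof -
  have "continuous_on {0..l} (\<lambda>x. (f x)\<^sup>2)" using assms by (intro continuous_intros)
  with assms show ?thesis
    unfolding square_integrable_def
    by (auto intro: edge_integrable_continuous borel_measurable_integrable)
qed

text \<open>\<open>ramp k\<close> is a \<open>C\<^sup>1\<close> approximation of \<open>max 0\<close> with error at most \<open>1 / (2 * k)\<close>; differences of its
  translates are test functions.\<close>

definition ramp :: "real \<Rightarrow> real \<Rightarrow> real" where
  "ramp k x = k / 2 * ((max 0 x)\<^sup>2 - (max 0 (x - 1 / k))\<^sup>2)"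

definition ramp' :: "real \<Rightarrow> real \<Rightarrow> real" where
  "ramp' k x = k * (max 0 x - max 0 (x - 1 / k))"

lemma has_real_derivative_max0_squared:
  "((\<lambda>x::real. (max 0 x)\<^sup>2) has_real_derivative 2 * max 0 x) (at x)"
proof -
  consider "x < 0" | "x > 0" | "x = 0" by linarith
  then show ?thesis
  proof cases
    case 1
    have "((\<lambda>x::real. 0) has_real_derivative 0) (at x)" by simp
    then have "((\<lambda>x::real. (max 0 x)\<^sup>2) has_real_derivative 0) (at x)"
      by (rule has_field_derivative_transform_within_open[where S = "{..<0}"]) (use 1 in auto)
    with 1 show ?thesis by simp
  next
    case 2
    have "((\<lambda>x::real. x\<^sup>2) has_real_derivative 2 * x) (at x)"
      by (auto intro!: derivative_eq_intros)
    then have "((\<lambda>x::real. (max 0 x)\<^sup>2) has_real_derivative 2 * x) (at x)"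
      by (rule has_field_derivative_transform_within_open[where S = "{0<..}"]) (use 2 in auto)
    with 2 show ?thesis by simp
  next
    case 3
    have "((\<lambda>h::real. (max 0 h)\<^sup>2 / h) \<longlongrightarrow> 0) (at 0)"
    proof (rule Lim_null_comparison[where g = "\<lambda>h. \<bar>h\<bar>"])
      show "\<forall>\<^sub>F h in at 0. norm ((max 0 h)\<^sup>2 / h) \<le> \<bar>h::real\<bar>"
        by (auto simp: max_def power2_eq_square)
      show "((\<lambda>h::real. \<bar>h\<bar>) \<longlongrightarrow> 0) (at 0)"
        by (intro tendsto_rabs_zero tendsto_ident_at)
    qed
    with 3 show ?thesis by (simp add: DERIV_def)
  qed
qed

lemma ramp_has_derivative: 
  assumes "0 < k"
  shows "((\<lambda>x. ramp k (x - a)) has_real_derivative ramp' k (x - a)) (at x)"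
proof -
  have 1: "((\<lambda>x. (max 0 (x - c))\<^sup>2) has_real_derivative 2 * max 0 (x - c)) (at x)" for c :: real
    using DERIV_chain'[OF _ has_real_derivative_max0_squared, of "\<lambda>x. x - c" 1 x UNIV]
    by (simp add: DERIV_diff[of "\<lambda>x. x" 1, OF DERIV_ident DERIV_const, simplified])
  have "((\<lambda>x. k / 2 * ((max 0 (x - a))\<^sup>2 - (max 0 (x - (a + 1 / k)))\<^sup>2)) has_real_derivative
      k / 2 * (2 * max 0 (x - a) - 2 * max 0 (x - (a + 1 / k)))) (at x)"
    by (intro DERIV_cmult DERIV_diff 1)
  then show ?thesis by (simp add: ramp_def ramp'_def algebra_simps)
qed

lemma continuous_on_ramp': "continuous_on S (\<lambda>x. ramp' k (x - a))"
  unfolding ramp'_def by (intro continuous_intros)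

lemma ramp_nonpos:
  assumes "0 < k" "x \<le> 0"
  shows "ramp k x = 0"
proof -
  have "x - 1 / k \<le> 0" using assms divide_pos_pos[of 1 k] by linarith
  then show ?thesis using assms(2) by (simp add: ramp_def)
qed

lemma ramp_ge: "0 < k \<Longrightarrow> 1 / k \<le> x \<Longrightarrow> ramp k x = x - 1 / (2 * k)"
proof -
  assume k: "0 < k" "1 / k \<le> x"
  moreover from k have "0 \<le> x" by (meson less_imp_le order_trans zero_le_divide_1_iff)
  ultimately show ?thesis
    by (simp add: ramp_def max_def power2_diff) (simp add: field_simps power2_eq_square)
qed

lemma ramp_approx:
  assumes "0 < k"
  shows "\<bar>ramp k x - max 0 x\<bar> \<le> 1 / (2 * k)"
proof -
  consider "x \<le> 0" | "1 / k \<le> x" | "0 < x" "x < 1 / k" by linarith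
  then show ?thesis
  proof cases
    case 1
    then show ?thesis using assms by (simp add: ramp_nonpos max_def)
  next
    case 2
    moreover from 2 assms have "0 \<le> x" by (meson less_imp_le order_trans zero_le_divide_1_iff)
    ultimately show ?thesis using assms by (simp add: ramp_ge max_def)
  next
    case 3
    then have kx: "0 < k * x" "k * x < 1" using assms by (auto simp: field_simps)
    have "ramp k x = k / 2 * x\<^sup>2" using 3 by (simp add: ramp_def max_def)
    \<comment> \<open>With \<open>t = k * x\<close> the scaled error is
      \<open>t * (2 - t) = 1 - (1 - t)\<^sup>2\<close>, which lies between 0 and 1 for
      \<open>t\<close> between 0 and 1.\<close>
    then have "2 * k * (max 0 x - ramp k x) = (k * x) * (2 - k * x)"
      using 3 by (simp add: max_def power2_eq_square algebra_simps)
    also have "0 \<le> \<dots> \<and> \<dots> \<le> 1"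
    proof
      show "0 \<le> (k * x) * (2 - k * x)" by (rule mult_nonneg_nonneg) (use kx in linarith)+
      show "(k * x) * (2 - k * x) \<le> 1"
        using zero_le_power2[of "1 - k * x"] by (simp add: power2_eq_square algebra_simps)
    qed
    finally have "0 \<le> k * (max 0 x - ramp k x)" "k * (max 0 x - ramp k x) \<le> 1 / 2" by auto
    then have "0 \<le> max 0 x - ramp k x" "max 0 x - ramp k x \<le> 1 / (2 * k)"
      using assms by (auto simp: zero_le_mult_iff pos_le_divide_eq mult.commute)
    then show ?thesis by linarith
  qed
qed

lemma ramp'_bounds:
  assumes "0 < k"
  shows "0 \<le> ramp' k x" "ramp' k x \<le> 1"
proof -
  have e: "0 < 1 / k" using assms by simp
  then have "max 0 (x - 1 / k) \<le> max 0 x" by linarith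
  with assms show "0 \<le> ramp' k x" by (simp add: ramp'_def)
  have "max 0 x - max 0 (x - 1 / k) \<le> 1 / k" using e by linarith
  from mult_left_mono[OF this, of k] assms show "ramp' k x \<le> 1" by (simp add: ramp'_def)
qed

lemma ramp'_eq_0:
  assumes "0 < k" "x \<le> 0"
  shows "ramp' k x = 0"
proof -
  have "x - 1 / k \<le> 0" using assms divide_pos_pos[of 1 k] by linarith
  then show ?thesis using assms(2) by (simp add: ramp'_def)
qed

lemma ramp'_eq_1: "0 < k \<Longrightarrow> 1 / k \<le> x \<Longrightarrow> ramp' k x = 1"
proof -
  assume k: "0 < k" "1 / k \<le> x"
  moreover from k have "0 \<le> x" by (meson less_imp_le order_trans zero_le_divide_1_iff)
  ultimately show ?thesis by (simp add: ramp'_def max_def field_simps)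
qed

lemma ramp_tendsto: "(\<lambda>n. ramp (real (Suc n)) x) \<longlonglongrightarrow> max 0 x"
proof -
  have "(\<lambda>n. ramp (real (Suc n)) x - max 0 x) \<longlonglongrightarrow> 0"
  proof (rule Lim_null_comparison)
    show "\<forall>\<^sub>F n in sequentially. norm (ramp (real (Suc n)) x - max 0 x) \<le> 1 / 2 * inverse (real (Suc n))"
      using ramp_approx[of "real (Suc n)" x for n] by (simp add: field_simps)
    show "(\<lambda>n. 1 / 2 * inverse (real (Suc n))) \<longlonglongrightarrow> 0"
      using tendsto_mult_right_zero[OF LIMSEQ_inverse_real_of_nat] .
  qed
  then show ?thesis by (simp add: LIM_zero_iff)
qed

text \<open>At 0 every \<open>ramp'\<close> vanishes, so the limit is the indicator of the open
  half-line; this is why the windows below are open on the left and closed on the right.\<close>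

lemma ramp'_tendsto: "(\<lambda>n. ramp' (real (Suc n)) x) \<longlonglongrightarrow> of_bool (0 < x)"
proof (cases "0 < x")
  case True
  obtain N where N: "inverse (real (Suc N)) < x" using reals_Archimedean[OF True] by blast
  have "ramp' (real (Suc n)) x = 1" if "n \<ge> N" for n
  proof (rule ramp'_eq_1)
    have "1 / real (Suc n) \<le> 1 / real (Suc N)" using that by (simp add: frac_le)
    also have "\<dots> < x" using N by (simp add: inverse_eq_divide)
    finally show "1 / real (Suc n) \<le> x" by simp
  qed simp
  then have "\<forall>\<^sub>F n in sequentially. ramp' (real (Suc n)) x = 1"
    by (auto simp: eventually_sequentially)
  then show ?thesis using True by (simp add: tendsto_eventually)
next
  case False
  then show ?thesis by (simp add: ramp'_eq_0)
qed


lemma borel_measurable_edge: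
  "f \<in> borel_measurable borel \<Longrightarrow> f \<in> borel_measurable (edge_measure l)"
  by (intro measurable_restrict_space1 measurable_completion) simp

lemma edge_integrable_mult_bounded:
  fixes f c :: "real \<Rightarrow> real"
  assumes "integrable (edge_measure l) f" "c \<in> borel_measurable borel" "\<And>x. \<bar>c x\<bar> \<le> C"
  shows "integrable (edge_measure l) (\<lambda>x. f x * c x)"
proof (rule Bochner_Integration.integrable_bound)
  show "integrable (edge_measure l) (\<lambda>x. C * \<bar>f x\<bar>)"
    using assms(1) by (intro integrable_mult_right integrable_abs)
  show "(\<lambda>x. f x * c x) \<in> borel_measurable (edge_measure l)"
    using borel_measurable_edge[OF assms(2)] borel_measurable_integrable[OF assms(1)] by measurable
  have "\<bar>f x * c x\<bar> \<le> \<bar>C * \<bar>f x\<bar>\<bar>" for x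
    using mult_left_mono[OF order_trans[OF assms(3)[of x] abs_ge_self], of "\<bar>f x\<bar>"]
    by (simp add: abs_mult mult.commute)
  then show "AE x in edge_measure l. norm (f x * c x) \<le> norm (C * \<bar>f x\<bar>)" by simp
qed

lemma edge_integral_upper:
  fixes f :: "real \<Rightarrow> real"
  assumes f: "integrable (edge_measure l) f" and p: "0 \<le> p" "p \<le> l"
  shows "(LINT x|edge_measure l. f x * of_bool (p < x)) = integral {p..l} f"
proof -
  have int: "integrable (edge_measure l) (\<lambda>x. f x * of_bool (p < x))"
    by (rule edge_integrable_mult_bounded[OF f, where C = 1]) auto
  then have on: "(\<lambda>x. f x * of_bool (p < x)) integrable_on {0..l}"
    unfolding edge_integrable_iff by (rule set_lebesgue_integral_eq_integral)
  have "(LINT x|edge_measure l. f x * of_bool (p < x))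
      = integral {0..p} (\<lambda>x. f x * of_bool (p < x)) + integral {p..l} (\<lambda>x. f x * of_bool (p < x))"
    unfolding edge_integral_eq[OF int]
    by (rule Henstock_Kurzweil_Integration.integral_combine[symmetric]) (use p on in auto)
  also have "integral {0..p} (\<lambda>x. f x * of_bool (p < x)) = integral {0..p} (\<lambda>x. 0)"
    by (rule integral_cong) auto
  also have "integral {p..l} (\<lambda>x. f x * of_bool (p < x)) = integral {p..l} f"
    by (rule integral_spike[of "{p}"]) auto
  finally show ?thesis by simp
qed

lemma edge_integral_window:
  fixes f :: "real \<Rightarrow> real"
  assumes f: "integrable (edge_measure l) f" and pq: "0 \<le> p" "p \<le> q" "q \<le> l"
  shows "(LINT x|edge_measure l. f x * (of_bool (p < x) - of_bool (q < x))) = integral {p..q} f"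
proof -
  have "(LINT x|edge_measure l. f x * (of_bool (p < x) - of_bool (q < x)))
      = (LINT x|edge_measure l. f x * of_bool (p < x)) - (LINT x|edge_measure l. f x * of_bool (q < x))"
    unfolding right_diff_distrib
    by (intro Bochner_Integration.integral_diff edge_integrable_mult_bounded[OF f, where C = 1]) auto
  also have "\<dots> = integral {p..l} f - integral {q..l} f"
    using pq by (simp add: edge_integral_upper[OF f])
  also have "\<dots> = integral {p..q} f"
  proof -
    have "f integrable_on {0..l}"
      using f unfolding edge_integrable_iff by (rule set_lebesgue_integral_eq_integral)
    then have "f integrable_on {p..l}" by (rule integrable_on_subinterval) (use pq in auto)
    from Henstock_Kurzweil_Integration.integral_combine[OF pq(2,3) this] show ?thesis by simp
  qed
  finally show ?thesis .
qed

text \<open>The weak derivative identity for the Lipschitz hat function whose derivative is the difference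
  of the indicators of \<open>(a, a + d]\<close> and \<open>(b, b + d]\<close>. For continuous \<open>f\<close>, letting \<open>d\<close> tend to \<open>0\<close>
  gives the fundamental theorem of calculus; for \<open>g = 0\<close> it is the du Bois-Reymond lemma.\<close>

lemma weak_deriv_hat:
  fixes f g :: "real \<Rightarrow> real"
  assumes f: "integrable (edge_measure l) f" and g: "integrable (edge_measure l) g"
    and fg: "has_weak_deriv l f g"
    and ab: "0 < a" "a \<le> b" "0 \<le> d" "b + d < l"
  shows "integral {a..a + d} f - integral {b..b + d} f
    = - (LINT x|edge_measure l. g x * (max 0 (x - a) - max 0 (x - (a + d))
          - (max 0 (x - b) - max 0 (x - (b + d)))))"
proof -
  \<comment> \<open>Starting the smoothing parameters beyond \<open>N\<close> keeps the support,
    which reaches up to \<open>b + d + 1 / k n\<close>, inside the open edge.\<close>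
  obtain N where N: "inverse (real (Suc N)) < l - (b + d)"
    using reals_Archimedean[of "l - (b + d)"] ab by auto
  define k where "k n = real (Suc (n + N))" for n
  have k: "0 < k n" for n by (simp add: k_def)
  have kN: "1 / k n < l - (b + d)" for n
  proof -
    have "1 / k n \<le> 1 / real (Suc N)" by (simp add: k_def frac_le)
    with N show ?thesis by (simp add: inverse_eq_divide)
  qed
  define \<phi> where "\<phi> n x = ramp (k n) (x - a) - ramp (k n) (x - (a + d))
      - (ramp (k n) (x - b) - ramp (k n) (x - (b + d)))" for n x
  define \<phi>' where "\<phi>' n x = ramp' (k n) (x - a) - ramp' (k n) (x - (a + d))
      - (ramp' (k n) (x - b) - ramp' (k n) (x - (b + d)))" for n x
  define \<psi> where "\<psi> x = max 0 (x - a) - max 0 (x - (a + d)) - (max 0 (x - b) - max 0 (x - (b + d)))" for x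
  define \<psi>' where "\<psi>' x = (of_bool (a < x) - of_bool (a + d < x))
      - (of_bool (b < x) - of_bool (b + d < x) :: real)" for x
  have deriv: "(\<phi> n has_real_derivative \<phi>' n x) (at x)" for n x
    unfolding \<phi>_def \<phi>'_def by (intro DERIV_diff ramp_has_derivative k)
  have cont': "continuous_on S (\<phi>' n)" for n S
    unfolding \<phi>'_def by (intro continuous_intros continuous_on_ramp')
  have cont: "continuous_on S (\<phi> n)" for n S
    unfolding \<phi>_def ramp_def by (intro continuous_intros)
  have meas: "\<phi> n \<in> borel_measurable borel" "\<phi>' n \<in> borel_measurable borel" for n
    using cont cont' by (auto intro: borel_measurable_continuous_onI)
  have test: "test_function l (\<phi> n)" for n
    unfolding test_function_def
  proof (intro conjI exI[of _ "{a..b + d + 1 / k n}"] allI impI)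
    show "\<phi> n C1_differentiable_on UNIV"
      unfolding C1_differentiable_on_def
      using deriv[of n] cont'[of UNIV n]
      by (intro exI[of _ "\<phi>' n"]) (auto simp: has_real_derivative_iff_has_vector_derivative)
    show "{a..b + d + 1 / k n} \<subseteq> {0<..<l}" using ab kN[of n] by auto
    fix x assume "x \<notin> {a..b + d + 1 / k n}"
    then consider "x \<le> a" | "b + d + 1 / k n \<le> x" by fastforce
    then show "\<phi> n x = 0"
    proof cases
      case 1
      then show ?thesis using ab k by (simp add: \<phi>_def ramp_nonpos)
    next
      case 2
      \<comment> \<open>To the right of the support all four ramps are affine with the same offset;
        both differences equal \<open>d\<close> and cancel.\<close>
      then show ?thesis using ab k by (simp add: \<phi>_def ramp_ge)
    qed
  qed simp
  have \<phi>'_le: "\<bar>\<phi>' n x\<bar> \<le> 2" for n x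
    using ramp'_bounds[OF k[of n], of "x - a"] ramp'_bounds[OF k[of n], of "x - (a + d)"]
      ramp'_bounds[OF k[of n], of "x - b"] ramp'_bounds[OF k[of n], of "x - (b + d)"]
    unfolding \<phi>'_def by linarith
  have \<phi>_le: "\<bar>\<phi> n x\<bar> \<le> 2 * d + 2" for n x
  proof -
    have "1 / (2 * k n) \<le> 1 / 2" by (simp add: k_def field_simps)
    then have *: "\<bar>ramp (k n) r - max 0 r\<bar> \<le> 1 / 2" for r
      using ramp_approx[OF k[of n], of r] by linarith
    show ?thesis
      using *[of "x - a"] *[of "x - (a + d)"] *[of "x - b"] *[of "x - (b + d)"] ab
      unfolding \<phi>_def by linarith
  qed
  have lim': "(\<lambda>n. \<phi>' n x) \<longlonglongrightarrow> \<psi>' x" for x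
  proof -
    have "(\<lambda>n. ramp' (k n) (x - r)) \<longlonglongrightarrow> of_bool (r < x)" for r
      using LIMSEQ_ignore_initial_segment[OF ramp'_tendsto[of "x - r"], of N] by (simp add: k_def)
    then show ?thesis unfolding \<phi>'_def \<psi>'_def by (intro tendsto_diff)
  qed
  have lim: "(\<lambda>n. \<phi> n x) \<longlonglongrightarrow> \<psi> x" for x
  proof -
    have "(\<lambda>n. ramp (k n) (x - r)) \<longlonglongrightarrow> max 0 (x - r)" for r
      using LIMSEQ_ignore_initial_segment[OF ramp_tendsto[of "x - r"], of N] by (simp add: k_def)
    then show ?thesis unfolding \<phi>_def \<psi>_def by (intro tendsto_diff)
  qed
  have mf: "f \<in> borel_measurable (edge_measure l)" and mg: "g \<in> borel_measurable (edge_measure l)"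
    using f g by (auto intro: borel_measurable_integrable)
  have lim_f: "(\<lambda>n. LINT x|edge_measure l. f x * \<phi>' n x) \<longlonglongrightarrow> (LINT x|edge_measure l. f x * \<psi>' x)"
  proof (rule integral_dominated_convergence[where w = "\<lambda>x. 2 * \<bar>f x\<bar>"])
    show "(\<lambda>x. f x * \<psi>' x) \<in> borel_measurable (edge_measure l)"
      unfolding \<psi>'_def by (intro borel_measurable_times mf borel_measurable_edge) measurable
    show "(\<lambda>x. f x * \<phi>' n x) \<in> borel_measurable (edge_measure l)" for n
      by (intro borel_measurable_times mf borel_measurable_edge meas)
    show "integrable (edge_measure l) (\<lambda>x. 2 * \<bar>f x\<bar>)" using f by simp
    show "AE x in edge_measure l. (\<lambda>n. f x * \<phi>' n x) \<longlonglongrightarrow> f x * \<psi>' x"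
      by (intro AE_I2 tendsto_mult_left lim')
    show "AE x in edge_measure l. norm (f x * \<phi>' n x) \<le> 2 * \<bar>f x\<bar>" for n
      using mult_left_mono[OF \<phi>'_le abs_ge_zero] by (intro AE_I2) (simp add: abs_mult mult.commute)
  qed
  have lim_g: "(\<lambda>n. LINT x|edge_measure l. g x * \<phi> n x) \<longlonglongrightarrow> (LINT x|edge_measure l. g x * \<psi> x)"
  proof (rule integral_dominated_convergence[where w = "\<lambda>x. (2 * d + 2) * \<bar>g x\<bar>"])
    show "(\<lambda>x. g x * \<psi> x) \<in> borel_measurable (edge_measure l)"
      unfolding \<psi>_def by (intro borel_measurable_times mg borel_measurable_edge) measurable
    show "(\<lambda>x. g x * \<phi> n x) \<in> borel_measurable (edge_measure l)" for n
      by (intro borel_measurable_times mg borel_measurable_edge meas)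
    show "integrable (edge_measure l) (\<lambda>x. (2 * d + 2) * \<bar>g x\<bar>)" using g by simp
    show "AE x in edge_measure l. (\<lambda>n. g x * \<phi> n x) \<longlonglongrightarrow> g x * \<psi> x"
      by (intro AE_I2 tendsto_mult_left lim)
    show "AE x in edge_measure l. norm (g x * \<phi> n x) \<le> (2 * d + 2) * \<bar>g x\<bar>" for n
      using mult_left_mono[OF \<phi>_le abs_ge_zero]
      by (intro AE_I2) (simp add: abs_mult mult.commute)
  qed
  have eq: "(LINT x|edge_measure l. f x * \<phi>' n x) = - (LINT x|edge_measure l. g x * \<phi> n x)" for n
  proof -
    have "deriv (\<phi> n) = \<phi>' n" using deriv by (intro ext DERIV_imp_deriv)
    with fg[unfolded has_weak_deriv_def, rule_format, OF test[of n]] show ?thesis by simp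
  qed
  have "(LINT x|edge_measure l. f x * \<psi>' x) = - (LINT x|edge_measure l. g x * \<psi> x)"
    by (rule LIMSEQ_unique[OF lim_f[unfolded eq] tendsto_minus[OF lim_g]])
  moreover have "(LINT x|edge_measure l. f x * \<psi>' x) = integral {a..a + d} f - integral {b..b + d} f"
  proof -
    have "(LINT x|edge_measure l. f x * \<psi>' x) =
        (LINT x|edge_measure l. f x * (of_bool (a < x) - of_bool (a + d < x)))
      - (LINT x|edge_measure l. f x * (of_bool (b < x) - of_bool (b + d < x)))"
      unfolding \<psi>'_def right_diff_distrib[of "f _" "_ - _"]
      by (intro Bochner_Integration.integral_diff edge_integrable_mult_bounded[OF f, where C = 1]) auto
    then show ?thesis using ab by (simp add: edge_integral_window[OF f])
  qed
  ultimately show ?thesis by (simp add: \<psi>_def)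
qed

section \<open>Fundamental theorem of calculus for weak derivatives\<close>

lemma difference_quotient_integral_tendsto:
  fixes f :: "real \<Rightarrow> real"
  assumes f: "continuous_on {0..l} f" and a: "0 < a" "a < l"
  shows "((\<lambda>d. integral {a..a + d} f / d) \<longlongrightarrow> f a) (at_right 0)"
proof -
  define F where "F x = integral {0..x} f" for x
  have "(F has_real_derivative f a) (at a within {0..l})"
    unfolding F_def by (rule integral_has_real_derivative[OF f]) (use a in auto)
  then have "(F has_real_derivative f a) (at a)"
    using a by (simp add: at_within_Icc_at)
  then have "((\<lambda>d. (F (a + d) - F a) / d) \<longlongrightarrow> f a) (at 0)" by (simp add: DERIV_def)
  then have "((\<lambda>d. (F (a + d) - F a) / d) \<longlongrightarrow> f a) (at_right 0)"
    by (rule tendsto_within_subset[where S = UNIV]) auto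
  moreover have "\<forall>\<^sub>F d in at_right 0. (F (a + d) - F a) / d = integral {a..a + d} f / d"
    unfolding eventually_at_right_field
  proof (intro exI[of _ "l - a"] conjI allI impI)
    fix d assume d: "0 < d" "d < l - a"
    have "f integrable_on {0..a + d}"
      using a d by (intro integrable_continuous_real continuous_on_subset[OF f]) auto
    from Henstock_Kurzweil_Integration.integral_combine[OF _ _ this, of a] a d
    show "(F (a + d) - F a) / d = integral {a..a + d} f / d" by (simp add: F_def)
  qed (use a in auto)
  ultimately show ?thesis by (rule Lim_transform_eventually)
qed

text \<open>Apply \<open>weak_deriv_hat\<close> with \<open>d = 1 / k n\<close> and multiply by
  \<open>k n\<close>: the window averages of \<open>f\<close> tend to \<open>f a\<close> and
  \<open>f b\<close> by continuity, while the scaled hat tends to the indicator of the interval from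
  \<open>a\<close> to \<open>b\<close>.\<close>

lemma weak_deriv_integral_interior:
  fixes f g :: "real \<Rightarrow> real"
  assumes f: "continuous_on {0..l} f" and g: "integrable (edge_measure l) g"
    and fg: "has_weak_deriv l f g"
    and ab: "0 < a" "a \<le> b" "b < l"
  shows "integral {a..b} g = f b - f a"
proof -
  obtain N where N: "inverse (real (Suc N)) < l - b"
    using reals_Archimedean[of "l - b"] ab by auto
  define k where "k n = real (Suc (n + N))" for n
  have k: "0 < k n" for n by (simp add: k_def)
  have kN: "1 / k n < l - b" for n
  proof -
    have "1 / k n \<le> 1 / real (Suc N)" by (simp add: k_def frac_le)
    with N show ?thesis by (simp add: inverse_eq_divide)
  qed
  have k0: "filterlim (\<lambda>n. 1 / k n) (at_right 0) sequentially"
    unfolding filterlim_at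
    using LIMSEQ_ignore_initial_segment[OF LIMSEQ_inverse_real_of_nat, of N] k
    by (simp add: k_def inverse_eq_divide)
  define \<phi> where "\<phi> n x = ramp' (k n) (x - a) - ramp' (k n) (x - b)" for n x
  define \<psi> where "\<psi> x = of_bool (a < x) - (of_bool (b < x) :: real)" for x
  have meas: "\<phi> n \<in> borel_measurable borel" for n
    unfolding \<phi>_def by (intro borel_measurable_continuous_onI continuous_intros continuous_on_ramp')
  have mg: "g \<in> borel_measurable (edge_measure l)" using g by (rule borel_measurable_integrable)
  have \<phi>_le: "\<bar>\<phi> n x\<bar> \<le> 1" for n x
    using ramp'_bounds[OF k[of n], of "x - a"] ramp'_bounds[OF k[of n], of "x - b"]
    unfolding \<phi>_def by linarith
  have "(\<lambda>n. LINT x|edge_measure l. g x * \<phi> n x) \<longlonglongrightarrow> (LINT x|edge_measure l. g x * \<psi> x)"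
  proof (rule integral_dominated_convergence[where w = "\<lambda>x. \<bar>g x\<bar>"])
    show "(\<lambda>x. g x * \<psi> x) \<in> borel_measurable (edge_measure l)"
      unfolding \<psi>_def by (intro borel_measurable_times mg borel_measurable_edge) measurable
    show "(\<lambda>x. g x * \<phi> n x) \<in> borel_measurable (edge_measure l)" for n
      by (intro borel_measurable_times mg borel_measurable_edge meas)
    show "integrable (edge_measure l) (\<lambda>x. \<bar>g x\<bar>)" using g by simp
    have "(\<lambda>n. ramp' (k n) (x - r)) \<longlonglongrightarrow> of_bool (r < x)" for r x
      using LIMSEQ_ignore_initial_segment[OF ramp'_tendsto[of "x - r"], of N] by (simp add: k_def)
    then show "AE x in edge_measure l. (\<lambda>n. g x * \<phi> n x) \<longlonglongrightarrow> g x * \<psi> x"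
      unfolding \<phi>_def \<psi>_def by (intro AE_I2 tendsto_mult_left tendsto_diff)
    show "AE x in edge_measure l. norm (g x * \<phi> n x) \<le> \<bar>g x\<bar>" for n
      using mult_left_mono[OF \<phi>_le abs_ge_zero] by (intro AE_I2) (simp add: abs_mult mult.commute)
  qed
  then have lim_g: "(\<lambda>n. - (LINT x|edge_measure l. g x * \<phi> n x)) \<longlonglongrightarrow> - integral {a..b} g"
    using ab unfolding \<psi>_def by (intro tendsto_minus) (simp add: edge_integral_window[OF g])
  have eq: "- (LINT x|edge_measure l. g x * \<phi> n x)
      = integral {a..a + 1 / k n} f / (1 / k n) - integral {b..b + 1 / k n} f / (1 / k n)" for n
  proof -
    have "integral {a..a + 1 / k n} f - integral {b..b + 1 / k n} f
      = - (LINT x|edge_measure l. g x * (max 0 (x - a) - max 0 (x - (a + 1 / k n))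
          - (max 0 (x - b) - max 0 (x - (b + 1 / k n)))))"
      using kN[of n] k[of n] ab
      by (intro weak_deriv_hat[OF edge_integrable_continuous[OF f] g fg]) auto
    also have "\<dots> = - (LINT x|edge_measure l. (g x * \<phi> n x) * (1 / k n))"
    proof -
      \<comment> \<open>\<open>ramp'\<close> is the difference quotient of the positive part with
        step \<open>1 / k n\<close>, so the scaled hat is exactly a difference of two translates of
        \<open>ramp'\<close>.\<close>
      have "max 0 (x - a) - max 0 (x - (a + 1 / k n)) - (max 0 (x - b) - max 0 (x - (b + 1 / k n)))
          = \<phi> n x * (1 / k n)" for x
      proof -
        have "(r * A - r * B) * (1 / r) = A - B" if "0 < r" for r A B :: real
          using that by (simp add: field_simps)
        from this[OF k[of n]] show ?thesis unfolding \<phi>_def ramp'_def diff_diff_eq by simp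
      qed
      then show ?thesis by (simp only: mult.assoc)
    qed
    also have "\<dots> = - (LINT x|edge_measure l. g x * \<phi> n x) * (1 / k n)"
      by simp
    finally show ?thesis
    proof -
      have "- Z = X / (1 / r) - Y / (1 / r)" if "0 < r" "X - Y = - Z * (1 / r)" for r X Y Z :: real
        using that by (simp add: field_simps)
      from this[OF k[of n]] show "X - Y = - Z * (1 / k n) \<Longrightarrow> - Z = X / (1 / k n) - Y / (1 / k n)" for X Y Z .
    qed
  qed
  have lim_f: "(\<lambda>n. integral {a..a + 1 / k n} f / (1 / k n) - integral {b..b + 1 / k n} f / (1 / k n))
      \<longlonglongrightarrow> f a - f b"
    using ab by (intro tendsto_diff filterlim_compose[OF difference_quotient_integral_tendsto[OF f] k0]) auto
  have "- integral {a..b} g = f a - f b"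
    by (rule LIMSEQ_unique[OF lim_g[unfolded eq] lim_f])
  then show ?thesis by simp
qed

text \<open>On the open edge \<open>f\<close> and the primitive of \<open>g\<close> differ by a
  constant. Both are continuous on the closed edge, so this extends to the endpoints, where the
  vertex conditions live.\<close>

lemma weak_deriv_has_integral:
  fixes f g :: "real \<Rightarrow> real"
  assumes f: "continuous_on {0..l} f" and g: "integrable (edge_measure l) g"
    and fg: "has_weak_deriv l f g"
    and ab: "0 \<le> a" "a \<le> b" "b \<le> l"
  shows "(g has_integral f b - f a) {a..b}"
proof (cases "a = b")
  case True
  then show ?thesis by (simp add: has_integral_refl)
next
  case False
  with ab have l: "0 < l" by simp
  have gi: "g integrable_on {0..l}"
    using g unfolding edge_integrable_iff by (rule set_lebesgue_integral_eq_integral)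
  define G where "G x = integral {0..x} g" for x
  have G: "integral {r..s} g = G s - G r" if "0 \<le> r" "r \<le> s" "s \<le> l" for r s
  proof -
    have "g integrable_on {0..s}" by (rule integrable_on_subinterval[OF gi]) (use that in auto)
    from Henstock_Kurzweil_Integration.integral_combine[OF that(1,2) this] show ?thesis by (simp add: G_def)
  qed
  have cont: "continuous_on {0..l} (\<lambda>x. f x - G x)"
    unfolding G_def by (intro continuous_on_diff f indefinite_integral_continuous_1 gi)
  define C where "C = f (l / 2) - G (l / 2)"
  have eq: "f x - G x = C" if "x \<in> {0<..<l}" for x
  proof (cases "x \<le> l / 2")
    case True
    then show ?thesis
      using that weak_deriv_integral_interior[OF f g fg, of x "l / 2"] G[of x "l / 2"] by (simp add: C_def)
  next
    case False
    then show ?thesis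
      using that weak_deriv_integral_interior[OF f g fg, of "l / 2" x] G[of "l / 2" x] by (simp add: C_def)
  qed
  have "f x - G x = C" if "x \<in> {0..l}" for x
    by (rule continuous_constant_on_closure[where S = "{0<..<l}"]) (use eq cont l that in auto)
  from this[of a] this[of b] G[OF ab] ab have "integral {a..b} g = f b - f a" by simp
  moreover have "g integrable_on {a..b}" by (rule integrable_on_subinterval[OF gi]) (use ab in auto)
  ultimately show ?thesis by (simp add: has_integral_iff)
qed

section \<open>Perimeter of unions of cells\<close>

lemma weak_deriv_props:
  assumes "f \<in> W12_interval l"
  shows "square_integrable l (weak_deriv l f)" "has_weak_deriv l f (weak_deriv l f)"
  using someI_ex[of "\<lambda>g. square_integrable l g \<and> has_weak_deriv l f g"] assms
  by (auto simp: W12_interval_def weak_deriv_def)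

text \<open>A violation would occur on a nonempty open set, which cannot be null. Thus the
  almost-everywhere bound on the test fields controls their values at the cuts.\<close>

lemma AE_abs_le_1_continuous:
  fixes z :: "real \<Rightarrow> real"
  assumes ae: "AE x in edge_measure l. \<bar>z x\<bar> \<le> 1" and z: "continuous_on {0..l} z"
    and x: "x \<in> {0<..<l}"
  shows "\<bar>z x\<bar> \<le> 1"
proof (rule ccontr)
  assume *: "\<not> \<bar>z x\<bar> \<le> 1"
  define S where "S = {0<..<l} \<inter> (\<lambda>x. \<bar>z x\<bar>) -` {1<..}"
  have "continuous_on {0<..<l} (\<lambda>x. \<bar>z x\<bar>)"
    by (intro continuous_intros continuous_on_subset[OF z]) auto
  then have "open S" unfolding S_def by (rule continuous_open_preimage) auto
  have "S \<noteq> {}" using x * by (auto simp: S_def)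
  with \<open>open S\<close> have "\<not> negligible S" by (rule open_not_negligible)
  moreover have "AE x in lebesgue. x \<in> {0<..<l} \<longrightarrow> \<bar>z x\<bar> \<le> 1"
    using ae by (subst (asm) AE_restrict_space_iff) auto
  then have "AE x in lebesgue. x \<notin> S" by (rule eventually_mono) (auto simp: S_def)
  then have "S \<in> null_sets lebesgue" using \<open>open S\<close> by (subst AE_iff_null_sets) auto
  ultimately show False by (simp add: negligible_iff_null_sets)
qed

text \<open>Abel summation with the boundary terms kept, since these carry the vertex values. For
  \<open>c = 1\<close> it is the telescoping sum of the cell lengths.\<close>

lemma sum_by_parts_step:
  fixes c Z :: "nat \<Rightarrow> real"
  shows "(\<Sum>j\<le>n. c j * (Z (Suc j) - Z j))
    = c n * Z (Suc n) - c 0 * Z 0 + (\<Sum>j<n. Z (Suc j) * (c j - c (Suc j)))"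
  by (induction n) (auto simp: algebra_simps)

text \<open>There are \<open>n + 1\<close> cells, bounded by \<open>p 0\<close> up to
  \<open>p (Suc n)\<close>. Half-open cells are disjoint and match the windows of
  \<open>edge_integral_window\<close>; the intersection removes the endpoint \<open>l\<close>, which
  does not belong to the open edge.\<close>

definition cell_union :: "real \<Rightarrow> (nat \<Rightarrow> real) \<Rightarrow> nat \<Rightarrow> (nat \<Rightarrow> bool) \<Rightarrow> real set" where
  "cell_union l p n \<kappa> = (\<Union>j\<in>{j \<in> {..n}. \<kappa> j}. {p j<..p (Suc j)}) \<inter> {0<..<l}"

lemma cell_union_sets: "cell_union l p n \<kappa> \<in> sets (edge_measure l)"
proof -
  have "cell_union l p n \<kappa> \<in> sets borel" unfolding cell_union_def by measurable
  then show ?thesis by (auto simp: sets_restrict_space_iff cell_union_def)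
qed

lemma cell_union_integral:
  fixes g :: "real \<Rightarrow> real"
  assumes p: "incseq p" "p 0 = 0" "p (Suc n) = l" and g: "integrable (edge_measure l) g"
  shows "(LINT x|edge_measure l. indicator (cell_union l p n \<kappa>) x * g x)
    = (\<Sum>j\<le>n. of_bool (\<kappa> j) * integral {p j..p (Suc j)} g)"
proof -
  let ?J = "{j \<in> {..n}. \<kappa> j}"
  have disj: "disjoint_family_on (\<lambda>j. {p j<..p (Suc j)}) ?J"
    unfolding disjoint_family_on_def
  proof (intro ballI impI)
    fix i j :: nat assume "i \<noteq> j"
    then have "Suc i \<le> j \<or> Suc j \<le> i" by auto
    then have "p (Suc i) \<le> p j \<or> p (Suc j) \<le> p i" using p(1) by (auto simp: incseq_def)
    then show "{p i<..p (Suc i)} \<inter> {p j<..p (Suc j)} = {}" by auto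
  qed
  have "(LINT x|edge_measure l. indicator (cell_union l p n \<kappa>) x * g x)
      = (LINT x|edge_measure l. (\<Sum>j\<in>?J. g x * (of_bool (p j < x) - of_bool (p (Suc j) < x))))"
  proof (rule Bochner_Integration.integral_cong)
    fix x assume "x \<in> space (edge_measure l)"
    then have "indicator (cell_union l p n \<kappa>) x = (indicator (\<Union>j\<in>?J. {p j<..p (Suc j)}) x :: real)"
      by (auto simp: cell_union_def indicator_def)
    also have "\<dots> = (\<Sum>j\<in>?J. indicator {p j<..p (Suc j)} x)"
      by (rule indicator_UN_disjoint[OF _ disj]) simp
    also have "\<dots> = (\<Sum>j\<in>?J. of_bool (p j < x) - of_bool (p (Suc j) < x))"
    proof (rule sum.cong)
      fix j
      have "p j \<le> p (Suc j)" using p(1) by (simp add: incseq_SucD)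
      then show "indicator {p j<..p (Suc j)} x = (of_bool (p j < x) - of_bool (p (Suc j) < x) :: real)"
        by (auto simp: indicator_def)
    qed simp
    finally show "indicator (cell_union l p n \<kappa>) x * g x
        = (\<Sum>j\<in>?J. g x * (of_bool (p j < x) - of_bool (p (Suc j) < x)))"
      by (simp add: sum_distrib_left mult.commute)
  qed simp
  also have "\<dots> = (\<Sum>j\<in>?J. LINT x|edge_measure l. g x * (of_bool (p j < x) - of_bool (p (Suc j) < x)))"
    by (intro Bochner_Integration.integral_sum edge_integrable_mult_bounded[OF g, where C = 1]) auto
  also have "\<dots> = (\<Sum>j\<in>?J. integral {p j..p (Suc j)} g)"
  proof (rule sum.cong)
    fix j assume "j \<in> ?J"
    then have "0 \<le> p j" "p j \<le> p (Suc j)" "p (Suc j) \<le> l"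
      using p(1) by (auto simp: incseq_def p(2)[symmetric] p(3)[symmetric])
    then show "(LINT x|edge_measure l. g x * (of_bool (p j < x) - of_bool (p (Suc j) < x)))
        = integral {p j..p (Suc j)} g"
      by (rule edge_integral_window[OF g])
  qed simp
  also have "\<dots> = (\<Sum>j\<le>n. if \<kappa> j then integral {p j..p (Suc j)} g else 0)"
    by (rule sum.inter_filter) simp
  also have "\<dots> = (\<Sum>j\<le>n. of_bool (\<kappa> j) * integral {p j..p (Suc j)} g)"
    by (intro sum.cong) auto
  finally show ?thesis .
qed

section \<open>Perimeter and length of cell unions on the whole graph\<close>

context compact_metric_graph
begin

text \<open>Double counting of incidences: every edge meets exactly two vertices, distinct because
  there are no loops. It serves the Kirchhoff condition of the test fields and later that of the
  normal derivatives.\<close>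

lemma sum_verts_incident:
  fixes \<nu> :: "'v \<Rightarrow> real" and A B :: "'e \<Rightarrow> real"
  shows "(\<Sum>v\<in>verts G. \<nu> v * (\<Sum>e\<in>incident_edges G v. if v = head G e then A e else B e))
    = (\<Sum>e\<in>arcs G. \<nu> (head G e) * A e + \<nu> (tail G e) * B e)"
proof -
  have "(\<Sum>v\<in>verts G. \<nu> v * (\<Sum>e\<in>incident_edges G v. if v = head G e then A e else B e))
    = (\<Sum>v\<in>verts G. \<Sum>e\<in>{e. e \<in> arcs G \<and> (tail G e = v \<or> head G e = v)}.
        \<nu> v * (if v = head G e then A e else B e))"
    by (simp add: incident_edges_def sum_distrib_left)
  also have "\<dots> = (\<Sum>e\<in>arcs G. \<Sum>v\<in>{v. v \<in> verts G \<and> (tail G e = v \<or> head G e = v)}.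
        \<nu> v * (if v = head G e then A e else B e))"
    by (rule sum.swap_restrict) simp_all
  also have "\<dots> = (\<Sum>e\<in>arcs G. \<nu> (head G e) * A e + \<nu> (tail G e) * B e)"
  proof (rule sum.cong)
    fix e assume e: "e \<in> arcs G"
    then have "{v. v \<in> verts G \<and> (tail G e = v \<or> head G e = v)} = {head G e, tail G e}" by auto
    then show "(\<Sum>v\<in>{v. v \<in> verts G \<and> (tail G e = v \<or> head G e = v)}.
        \<nu> v * (if v = head G e then A e else B e)) = \<nu> (head G e) * A e + \<nu> (tail G e) * B e"
      using no_loops[OF e] by simp
  qed simp
  finally show ?thesis .
qed

lemma continuous_at_vertices_imp_vertex_function:
  assumes "continuous_at_vertices G len u"
  shows "\<exists>\<nu>. \<forall>e\<in>arcs G. u e 0 = \<nu> (tail G e) \<and> u e (len e) = \<nu> (head G e)"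
proof (intro exI ballI conjI)
  \<comment> \<open>Continuity makes the choice of the incident edge immaterial.\<close>
  define \<nu> where "\<nu> v = vertex_value G len u (SOME e. e \<in> incident_edges G v) v" for v
  have \<nu>: "vertex_value G len u e v = \<nu> v" if "v \<in> verts G" "e \<in> incident_edges G v" for e v
    using assms that someI[of "\<lambda>e. e \<in> incident_edges G v" e]
    unfolding continuous_at_vertices_def \<nu>_def by blast
  fix e assume e: "e \<in> arcs G"
  show "u e 0 = \<nu> (tail G e)"
    using \<nu>[of "tail G e" e] e no_loops[OF e] by (simp add: incident_edges_def vertex_value_def)
  show "u e (len e) = \<nu> (head G e)"
    using \<nu>[of "head G e" e] e by (simp add: incident_edges_def vertex_value_def)
qed

text \<open>By \<open>tl\<close> and \<open>hd\<close> the cells around a vertex are all inside or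
  all outside. After summation by parts the endpoint values of \<open>z\<close> therefore collect,
  vertex by vertex, into the Kirchhoff sum times the membership of the vertex. What remains are the
  jumps at interior cuts, each multiplied by a value of \<open>z\<close> of modulus at most
  1.\<close>

lemma perimeter_cell_union_le:
  assumes p: "\<And>e. e \<in> arcs G \<Longrightarrow> incseq (p e)" "\<And>e. e \<in> arcs G \<Longrightarrow> p e 0 = 0"
      "\<And>e. e \<in> arcs G \<Longrightarrow> p e (Suc n) = len e"
    and inner: "\<And>e j. e \<in> arcs G \<Longrightarrow> j < n \<Longrightarrow> p e (Suc j) \<in> {0<..<len e}"
    and tl: "\<And>e. e \<in> arcs G \<Longrightarrow> \<kappa> e 0 = \<nu> (tail G e)"
    and hd: "\<And>e. e \<in> arcs G \<Longrightarrow> \<kappa> e n = \<nu> (head G e)"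
  shows "perimeter G len (\<lambda>e. cell_union (len e) (p e) n (\<kappa> e))
    \<le> ereal (\<Sum>e\<in>arcs G. \<Sum>j<n. \<bar>of_bool (\<kappa> e j) - of_bool (\<kappa> e (Suc j))\<bar>)"
  unfolding perimeter_def total_variation_def
proof (rule SUP_least)
  fix z assume "z \<in> {z \<in> X_K G len. Linf_norm_le_1 G len z}"
  then have z: "z \<in> W12 G len" and le1: "Linf_norm_le_1 G len z"
    and kirchhoff: "\<And>v. v \<in> verts G \<Longrightarrow> (\<Sum>e\<in>incident_edges G v. signed_vertex_value G len z e v) = 0"
    by (auto simp: X_K_def)
  define c where "c e j = (of_bool (\<kappa> e j) :: real)" for e j
  let ?I = "\<lambda>e. LINT x|edge_measure (len e). indicator (cell_union (len e) (p e) n (\<kappa> e)) x * edge_deriv len z e x"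
  let ?R = "\<lambda>e. \<Sum>j<n. z e (p e (Suc j)) * (c e j - c e (Suc j))"
  have I: "?I e = of_bool (\<nu> (head G e)) * z e (len e) + of_bool (\<nu> (tail G e)) * (- z e 0) + ?R e"
    if e: "e \<in> arcs G" for e
  proof -
    have ze: "z e \<in> W12_interval (len e)" "continuous_on {0..len e} (z e)"
      using z e by (auto simp: W12_def)
    have int: "integrable (edge_measure (len e)) (edge_deriv len z e)"
      using weak_deriv_props[OF ze(1)] by (simp add: edge_deriv_def square_integrable_imp_integrable)
    have "?I e = (\<Sum>j\<le>n. c e j * integral {p e j..p e (Suc j)} (edge_deriv len z e))"
      unfolding c_def by (rule cell_union_integral) (use p e int in auto)
    also have "\<dots> = (\<Sum>j\<le>n. c e j * (z e (p e (Suc j)) - z e (p e j)))"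
    proof (rule sum.cong)
      fix j assume j: "j \<in> {..n}"
      have "incseq (p e)" using p e by simp
      then have "p e 0 \<le> p e j" "p e j \<le> p e (Suc j)" "p e (Suc j) \<le> p e (Suc n)"
        using j by (auto simp: incseq_def)
      then have "(edge_deriv len z e has_integral z e (p e (Suc j)) - z e (p e j)) {p e j..p e (Suc j)}"
        using weak_deriv_has_integral[OF ze(2) int] weak_deriv_props[OF ze(1)] p[OF e]
        by (simp add: edge_deriv_def)
      then show "c e j * integral {p e j..p e (Suc j)} (edge_deriv len z e)
          = c e j * (z e (p e (Suc j)) - z e (p e j))" by (simp add: integral_unique)
    qed simp
    also have "\<dots> = c e n * z e (p e (Suc n)) - c e 0 * z e (p e 0) + ?R e"
      by (rule sum_by_parts_step)
    finally show ?thesis using p[OF e] hd[OF e] tl[OF e] by (simp add: c_def)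
  qed
  have R: "\<bar>?R e\<bar> \<le> (\<Sum>j<n. \<bar>c e j - c e (Suc j)\<bar>)" if e: "e \<in> arcs G" for e
  proof (intro order_trans[OF sum_abs] sum_mono)
    fix j assume j: "j \<in> {..<n}"
    have "\<bar>z e (p e (Suc j))\<bar> \<le> 1"
      using z le1 e inner[of e j] j
      by (intro AE_abs_le_1_continuous[where l = "len e"]) (auto simp: W12_def Linf_norm_le_1_def)
    from mult_right_mono[OF this abs_ge_zero]
    show "\<bar>z e (p e (Suc j)) * (c e j - c e (Suc j))\<bar> \<le> \<bar>c e j - c e (Suc j)\<bar>"
      by (simp add: abs_mult)
  qed
  have "graph_integral G len (\<lambda>e x. indicator (cell_union (len e) (p e) n (\<kappa> e)) x * edge_deriv len z e x)
      = (\<Sum>e\<in>arcs G. of_bool (\<nu> (head G e)) * z e (len e) + of_bool (\<nu> (tail G e)) * (- z e 0))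
        + (\<Sum>e\<in>arcs G. ?R e)"
    unfolding graph_integral_def sum.distrib[symmetric] by (intro sum.cong) (simp_all add: I)
  also have "(\<Sum>e\<in>arcs G. of_bool (\<nu> (head G e)) * z e (len e) + of_bool (\<nu> (tail G e)) * (- z e 0))
      = (\<Sum>v\<in>verts G. of_bool (\<nu> v) *
          (\<Sum>e\<in>incident_edges G v. if v = head G e then z e (len e) else - z e 0))"
    by (rule sum_verts_incident[symmetric])
  also have "\<dots> = 0"
    using kirchhoff by (intro sum.neutral) (simp add: signed_vertex_value_def)
  finally have "\<bar>graph_integral G len
        (\<lambda>e x. indicator (cell_union (len e) (p e) n (\<kappa> e)) x * edge_deriv len z e x)\<bar>
      = \<bar>\<Sum>e\<in>arcs G. ?R e\<bar>" by simp
  also have "\<dots> \<le> (\<Sum>e\<in>arcs G. \<Sum>j<n. \<bar>c e j - c e (Suc j)\<bar>)"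
    by (rule order_trans[OF sum_abs sum_mono[OF R]])
  finally show "ereal \<bar>graph_integral G len
        (\<lambda>e x. indicator (cell_union (len e) (p e) n (\<kappa> e)) x * edge_deriv len z e x)\<bar>
      \<le> ereal (\<Sum>e\<in>arcs G. \<Sum>j<n. \<bar>of_bool (\<kappa> e j) - of_bool (\<kappa> e (Suc j))\<bar>)"
    by (simp add: c_def)
qed

lemma cell_union_length:
  assumes p: "\<And>e. e \<in> arcs G \<Longrightarrow> incseq (p e)" "\<And>e. e \<in> arcs G \<Longrightarrow> p e 0 = 0"
      "\<And>e. e \<in> arcs G \<Longrightarrow> p e (Suc n) = len e"
  shows "graph_length G len (\<lambda>e. cell_union (len e) (p e) n (\<kappa> e))
    = (\<Sum>e\<in>arcs G. \<Sum>j\<le>n. (p e (Suc j) - p e j) * of_bool (\<kappa> e j))"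
  unfolding graph_length_def graph_integral_def
proof (rule sum.cong)
  fix e assume e: "e \<in> arcs G"
  have "(LINT x|edge_measure (len e). indicator (cell_union (len e) (p e) n (\<kappa> e)) x * 1 :: real)
      = (\<Sum>j\<le>n. of_bool (\<kappa> e j) * integral {p e j..p e (Suc j)} (\<lambda>x. 1))"
    by (rule cell_union_integral[where g = "\<lambda>x. 1"]) (use p e edge_integrable_continuous[of "len e" "\<lambda>x. 1"] in auto)
  also have "\<dots> = (\<Sum>j\<le>n. (p e (Suc j) - p e j) * of_bool (\<kappa> e j))"
    using p(1)[OF e] by (intro sum.cong) (auto simp: incseq_SucD)
  finally show "(LINT x|edge_measure (len e). indicator (cell_union (len e) (p e) n (\<kappa> e)) x)
      = (\<Sum>j\<le>n. (p e (Suc j) - p e j) * of_bool (\<kappa> e j))" by simp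
qed simp

lemma whole_graph_length: "graph_length G len (whole_graph len) = (\<Sum>e\<in>arcs G. len e)"
  unfolding graph_length_def graph_integral_def whole_graph_def
proof (rule sum.cong)
  fix e assume e: "e \<in> arcs G"
  have "(LINT x|edge_measure (len e). indicator {0<..<len e} x :: real) = (LINT x|edge_measure (len e). 1)"
    by (rule Bochner_Integration.integral_cong) auto
  also have "\<dots> = integral {0..len e} (\<lambda>x. 1)"
    by (rule edge_integral_eq) (rule edge_integrable_continuous, simp)
  finally show "(LINT x|edge_measure (len e). indicator {0<..<len e} x) = len e"
    using len_pos[OF e] by simp
qed simp

text \<open>A real \<open>h\<close> not exceeding the Cheeger constant turns the infimum of
  extended-real quotients into a linear inequality between real sums.\<close>

lemma cheeger_constant_cell_union:
  assumes p: "\<And>e. e \<in> arcs G \<Longrightarrow> incseq (p e)" "\<And>e. e \<in> arcs G \<Longrightarrow> p e 0 = 0"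
      "\<And>e. e \<in> arcs G \<Longrightarrow> p e (Suc n) = len e"
    and inner: "\<And>e j. e \<in> arcs G \<Longrightarrow> j < n \<Longrightarrow> p e (Suc j) \<in> {0<..<len e}"
    and tl: "\<And>e. e \<in> arcs G \<Longrightarrow> \<kappa> e 0 = \<nu> (tail G e)"
    and hd: "\<And>e. e \<in> arcs G \<Longrightarrow> \<kappa> e n = \<nu> (head G e)"
    and h: "ereal h \<le> cheeger_constant G len"
    and half: "(\<Sum>e\<in>arcs G. \<Sum>j\<le>n. (p e (Suc j) - p e j) * of_bool (\<kappa> e j)) \<le> (\<Sum>e\<in>arcs G. len e) / 2"
  shows "h * (\<Sum>e\<in>arcs G. \<Sum>j\<le>n. (p e (Suc j) - p e j) * of_bool (\<kappa> e j))
    \<le> (\<Sum>e\<in>arcs G. \<Sum>j<n. \<bar>of_bool (\<kappa> e j) - of_bool (\<kappa> e (Suc j))\<bar>)"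
proof -
  define D where "D = (\<lambda>e. cell_union (len e) (p e) n (\<kappa> e))"
  define m where "m = (\<Sum>e\<in>arcs G. \<Sum>j\<le>n. (p e (Suc j) - p e j) * of_bool (\<kappa> e j))"
  define N where "N = (\<Sum>e\<in>arcs G. \<Sum>j<n. \<bar>of_bool (\<kappa> e j) - of_bool (\<kappa> e (Suc j))\<bar> :: real)"
  have len: "graph_length G len D = m" unfolding D_def m_def by (rule cell_union_length[OF p])
  have meas: "measurable_subset G len D"
    by (simp add: measurable_subset_def D_def cell_union_sets)
  have "0 \<le> m"
    using p(1) by (auto simp: m_def incseq_SucD intro!: sum_nonneg)
  then consider "m = 0" | "0 < m" by linarith
  then have "h * m \<le> N"
  proof cases
    \<comment> \<open>Sets of length zero are not competitors in the infimum, but for them the left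
      side vanishes.\<close>
    case 1
    then show ?thesis by (simp add: N_def sum_nonneg)
  next
    case 2
    have "ereal h \<le> perimeter G len D / ereal m"
    proof (rule order_trans[OF h], unfold cheeger_constant_def, rule INF_lower2[of D])
      show "D \<in> {D. measurable_subset G len D \<and> 0 < graph_length G len D \<and>
                 graph_length G len D \<le> 1/2 * graph_length G len (whole_graph len)}"
        using 2 meas half[folded m_def] by (simp add: whole_graph_length len)
    qed (simp add: len)
    also have "\<dots> \<le> ereal N / ereal m"
      using 2 perimeter_cell_union_le[OF p inner tl hd] unfolding D_def N_def
      by (intro ereal_divide_right_mono) auto
    finally have "h \<le> N / m" using 2 by simp
    with 2 show ?thesis by (simp add: pos_le_divide_eq)
  qed
  then show ?thesis by (simp add: m_def N_def)
qed

end

section \<open>Passage to the limit in the grid\<close>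

lemma integral_sum_partition:
  fixes f :: "real \<Rightarrow> real" and p :: "nat \<Rightarrow> real"
  assumes p: "incseq p" and f: "f integrable_on {p 0..p n}"
  shows "(\<Sum>j<n. integral {p j..p (Suc j)} f) = integral {p 0..p n} f"
  using f
proof (induction n)
  case (Suc n)
  have le: "p 0 \<le> p n" "p n \<le> p (Suc n)" using p by (auto simp: incseq_def)
  have "f integrable_on {p 0..p n}"
    by (rule integrable_on_subinterval[OF Suc.prems]) (use le in auto)
  then show ?case
    using Suc.IH Henstock_Kurzweil_Integration.integral_combine[OF le Suc.prems] by simp
qed simp

text \<open>Cauchy-Schwarz, read off from the nonnegative integral of
  \<open>(g x - m)\<^sup>2\<close> with \<open>m\<close> the mean value of \<open>g\<close>.\<close>

lemma has_integral_square_le: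
  fixes g :: "real \<Rightarrow> real"
  assumes "a < b" and g: "(g has_integral I) {a..b}" and g2: "(\<lambda>x. (g x)\<^sup>2) integrable_on {a..b}"
  shows "I\<^sup>2 / (b - a) \<le> integral {a..b} (\<lambda>x. (g x)\<^sup>2)"
proof -
  define m where "m = I / (b - a)"
  have "((\<lambda>x. (g x)\<^sup>2 - 2 * m * g x + m\<^sup>2) has_integral
      integral {a..b} (\<lambda>x. (g x)\<^sup>2) - 2 * m * I + m\<^sup>2 * (b - a)) {a..b}"
    using has_integral_const_real[of "m\<^sup>2" a b] assms(1)
    by (intro has_integral_add has_integral_diff has_integral_mult_right integrable_integral g g2)
      (simp add: mult.commute)
  then have "0 \<le> integral {a..b} (\<lambda>x. (g x)\<^sup>2) - 2 * m * I + m\<^sup>2 * (b - a)"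
  proof (rule has_integral_nonneg)
    show "0 \<le> (g x)\<^sup>2 - 2 * m * g x + m\<^sup>2" for x
      using zero_le_power2[of "g x - m"] by (simp add: power2_diff algebra_simps)
  qed
  moreover have "2 * m * I - m\<^sup>2 * (b - a) = I\<^sup>2 / (b - a)"
  proof -
    have "I = m * (b - a)" using assms(1) by (simp add: m_def)
    then have "2 * m * I - m\<^sup>2 * (b - a) = m * I" by (simp add: power2_eq_square)
    then show ?thesis by (simp add: m_def power2_eq_square)
  qed
  ultimately show ?thesis by linarith
qed

section \<open>Nodes, cell boundaries and quadrature on a uniform grid\<close>

definition grid_node :: "real \<Rightarrow> nat \<Rightarrow> nat \<Rightarrow> real" where
  "grid_node l n j = l / real n * real j"

text \<open>For \<open>n > 0\<close> these bound the cells around the \<open>n + 1\<close> nodes: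
  the midpoints between neighbouring nodes and the two ends of the edge. Cell \<open>j\<close> lies
  between cuts \<open>j\<close> and \<open>j + 1\<close>; the two end cells have only half a step,
  as in the trapezoidal rule.\<close>

definition grid_cut :: "real \<Rightarrow> nat \<Rightarrow> nat \<Rightarrow> real" where
  "grid_cut l n j = (if j = 0 then 0 else if j \<le> n then l / real n * (real j - 1 / 2) else l)"

lemma grid_node_0 [simp]: "grid_node l n 0 = 0"
  by (simp add: grid_node_def)

lemma grid_node_last [simp]: "0 < n \<Longrightarrow> grid_node l n n = l"
  by (simp add: grid_node_def)

lemma incseq_grid_node: "0 \<le> l \<Longrightarrow> incseq (grid_node l n)"
  by (auto simp: incseq_def grid_node_def intro!: mult_left_mono divide_right_mono)

lemma grid_node_bounds:
  assumes "0 < l" "0 < n" "j \<le> n"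
  shows "0 \<le> grid_node l n j" "grid_node l n j \<le> l"
  using incseq_grid_node[of l n] assms grid_node_last[of n l] grid_node_0[of l n]
  unfolding incseq_def by (metis le0 less_imp_le, metis less_imp_le)

lemma grid_cut_0 [simp]: "grid_cut l n 0 = 0"
  by (simp add: grid_cut_def)

lemma grid_cut_last [simp]: "grid_cut l n (Suc n) = l"
  by (simp add: grid_cut_def)

lemma grid_cut_inner:
  assumes "0 < l" "j < n"
  shows "grid_cut l n (Suc j) = l / real n * (real j + 1 / 2)" "grid_cut l n (Suc j) \<in> {0<..<l}"
proof -
  show eq: "grid_cut l n (Suc j) = l / real n * (real j + 1 / 2)"
    using assms by (simp add: grid_cut_def algebra_simps)
  have "l * (real j + 1 / 2) < l * real n" using assms by (intro mult_strict_left_mono) auto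
  then show "grid_cut l n (Suc j) \<in> {0<..<l}"
    unfolding eq using assms by (simp add: divide_less_eq add_nonneg_pos)
qed

lemma incseq_grid_cut:
  assumes "0 < l" "0 < n"
  shows "incseq (grid_cut l n)"
proof (rule incseq_SucI)
  fix j
  consider "j = 0" | i where "j = Suc i" "j < n" | i where "j = Suc i" "j = n" | "n < j"
    using not0_implies_Suc by (metis linorder_neqE_nat)
  then show "grid_cut l n j \<le> grid_cut l n (Suc j)"
  proof cases
    case 1
    then show ?thesis using grid_cut_inner(2)[of l 0 n] assms by simp
  next
    case 2
    then show ?thesis using grid_cut_inner(1)[of l j n] grid_cut_inner(1)[of l i n] assms
      by (simp add: mult_left_mono divide_right_mono)
  next
    case 3
    then show ?thesis using grid_cut_inner(2)[of l i n] assms by simp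
  next
    case 4
    then show ?thesis by (simp add: grid_cut_def)
  qed
qed

lemma grid_cell_near_node:
  assumes "0 < l" "0 < n" "j \<le> n" and x: "x \<in> {grid_cut l n j..grid_cut l n (Suc j)}"
  shows "\<bar>x - grid_node l n j\<bar> \<le> l / real n"
proof -
  define d where "d = l / real n"
  have d: "0 < d" using assms by (simp add: d_def)
  \<comment> \<open>The end cells are cut off at 0 and \<open>l\<close>, so the midpoint formulas
    for the cell ends hold as inequalities.\<close>
  have "d * (real j - 1 / 2) \<le> grid_cut l n j"
    using assms d by (auto simp: grid_cut_def d_def[symmetric])
  moreover have "grid_cut l n (Suc j) \<le> d * (real j + 1 / 2)"
  proof (cases "j = n")
    case True
    have "l = d * real n" using assms by (simp add: d_def)
    with True d show ?thesis by (simp add: algebra_simps)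
  next
    case False
    then show ?thesis using grid_cut_inner(1)[of l j n] assms by (simp add: d_def)
  qed
  ultimately show ?thesis
    using x d by (simp add: grid_node_def d_def[symmetric] abs_le_iff algebra_simps)
qed

text \<open>The trapezoidal rule summed by steps and by nodes: each step gives half of its length to
  either end. This is the origin of the factor 2 in the weight hypothesis of the discrete
  inequality.\<close>

lemma grid_trapezoid:
  assumes "0 < l" "0 < n"
  shows "(\<Sum>j<n. l / real n * (f j + f (Suc j)))
    = 2 * (\<Sum>j\<le>n. (grid_cut l n (Suc j) - grid_cut l n j) * f j)"
proof -
  define d where "d = l / real n"
  \<comment> \<open>Both sides are brought to the same Abel-summed form; for \<open>m = n\<close>
    the boundary term is \<open>l * f n\<close>.\<close>
  have ind: "(\<Sum>j<m. d * (f j + f (Suc j)))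
      = 2 * (real m * d * f m + (\<Sum>j<m. d * (real j + 1 / 2) * (f j - f (Suc j))))" for m
    by (induction m) (auto simp: algebra_simps)
  have "(\<Sum>j\<le>n. (grid_cut l n (Suc j) - grid_cut l n j) * f j)
      = f n * l + (\<Sum>j<n. grid_cut l n (Suc j) * (f j - f (Suc j)))"
    using sum_by_parts_step[of f "grid_cut l n" n] by (simp add: mult.commute)
  also have "(\<Sum>j<n. grid_cut l n (Suc j) * (f j - f (Suc j)))
      = (\<Sum>j<n. d * (real j + 1 / 2) * (f j - f (Suc j)))"
    by (intro sum.cong) (simp_all add: grid_cut_inner(1) assms d_def)
  also have "f n * l = real n * d * f n" using assms by (simp add: d_def)
  finally show ?thesis using ind[of n] by (simp add: d_def mult.commute)
qed

text \<open>Each cell stays within one step of its node, so uniform continuity bounds its error by a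
  small multiple of its length. The index \<open>Suc m\<close> keeps the number of steps
  positive.\<close>

lemma grid_riemann_sum_tendsto:
  fixes f :: "real \<Rightarrow> real"
  assumes l: "0 < l" and f: "continuous_on {0..l} f"
  shows "(\<lambda>m. \<Sum>j\<le>Suc m. (grid_cut l (Suc m) (Suc j) - grid_cut l (Suc m) j) * f (grid_node l (Suc m) j))
    \<longlonglongrightarrow> integral {0..l} f"
proof (rule LIMSEQ_I)
  fix r :: real assume r: "0 < r"
  \<comment> \<open>The cell errors add up to at most \<open>\<epsilon> * l = r / 2\<close>.\<close>
  define \<epsilon> where "\<epsilon> = r / (2 * l)"
  have \<epsilon>: "0 < \<epsilon>" using r l by (simp add: \<epsilon>_def)
  have "uniformly_continuous_on {0..l} f"
    by (rule compact_uniformly_continuous[OF f]) simp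
  then obtain d where d: "0 < d"
    and fd: "\<And>x y. x \<in> {0..l} \<Longrightarrow> y \<in> {0..l} \<Longrightarrow> \<bar>x - y\<bar> < d \<Longrightarrow> \<bar>f x - f y\<bar> < \<epsilon>"
    using \<epsilon> unfolding uniformly_continuous_on_def dist_real_def by metis
  obtain N where N: "inverse (real (Suc N)) < d / l"
    using reals_Archimedean[of "d / l"] d l by auto
  have close: "norm ((\<Sum>j\<le>n. (grid_cut l n (Suc j) - grid_cut l n j) * f (grid_node l n j))
      - integral {0..l} f) < r" if "Suc N \<le> n" for n
  proof -
    have n: "0 < n" using that by simp
    have "l / real n \<le> l * inverse (real (Suc N))"
      unfolding divide_inverse using that l by (intro mult_left_mono le_imp_inverse_le) auto
    also have "\<dots> < d" using N l by (simp add: field_simps)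
    finally have ln: "l / real n < d" .
    let ?p = "grid_cut l n"
    have p: "incseq ?p" by (rule incseq_grid_cut[OF l n])
    have fi: "f integrable_on {?p 0..?p (Suc n)}"
      using f by (simp add: integrable_continuous_real)
    have "\<bar>(?p (Suc j) - ?p j) * f (grid_node l n j) - integral {?p j..?p (Suc j)} f\<bar>
        \<le> \<epsilon> * (?p (Suc j) - ?p j)" if j: "j \<le> n" for j
    proof -
      have le: "?p 0 \<le> ?p j" "?p j \<le> ?p (Suc j)" "?p (Suc j) \<le> ?p (Suc n)"
        using incseqD[OF p, of 0 j] incseqD[OF p, of j "Suc j"] incseqD[OF p, of "Suc j" "Suc n"] j
        by (simp_all del: grid_cut_0 grid_cut_last)
      have "f integrable_on {?p j..?p (Suc j)}"
        by (rule integrable_on_subinterval[OF fi]) (use le in auto)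
      then have "((\<lambda>x. f x - f (grid_node l n j)) has_integral
          (integral {?p j..?p (Suc j)} f - (?p (Suc j) - ?p j) * f (grid_node l n j))) {?p j..?p (Suc j)}"
        using has_integral_const_real[of "f (grid_node l n j)" "?p j" "?p (Suc j)"] le
        by (intro has_integral_diff integrable_integral) auto
      then have "norm (integral {?p j..?p (Suc j)} f - (?p (Suc j) - ?p j) * f (grid_node l n j))
          \<le> \<epsilon> * measure lborel {?p j..?p (Suc j)}"
      proof (rule has_integral_bound_real[where S = "{}", rotated 2])
        fix x assume "x \<in> {?p j..?p (Suc j)} - {}"
        then have x: "x \<in> {?p j..?p (Suc j)}" by simp
        have "\<bar>x - grid_node l n j\<bar> < d"
          using grid_cell_near_node[OF l n j x] ln by linarith
        moreover have "x \<in> {0..l}" using x le by auto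
        ultimately show "norm (f x - f (grid_node l n j)) \<le> \<epsilon>"
          using fd[of x "grid_node l n j"] grid_node_bounds[OF l n j] by simp
      qed (use \<epsilon> in auto)
      then show ?thesis using le by (simp add: abs_minus_commute)
    qed
    note cell = this
    have tele: "(\<Sum>j\<le>n. ?p (Suc j) - ?p j) = l"
      using sum_by_parts_step[of "\<lambda>j. 1" ?p n] by simp
    have "integral {0..l} f = (\<Sum>j\<le>n. integral {?p j..?p (Suc j)} f)"
      using integral_sum_partition[OF p fi] by (simp add: lessThan_Suc_atMost)
    then have "norm ((\<Sum>j\<le>n. (?p (Suc j) - ?p j) * f (grid_node l n j)) - integral {0..l} f)
        = \<bar>\<Sum>j\<le>n. (?p (Suc j) - ?p j) * f (grid_node l n j) - integral {?p j..?p (Suc j)} f\<bar>"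
      by (simp add: sum_subtractf)
    also have "\<dots> \<le> (\<Sum>j\<le>n. \<epsilon> * (?p (Suc j) - ?p j))"
      by (rule order_trans[OF sum_abs sum_mono]) (use cell in auto)
    also have "\<dots> = \<epsilon> * l" by (simp add: sum_distrib_left[symmetric] tele)
    also have "\<dots> < r" using r l by (simp add: \<epsilon>_def)
    finally show ?thesis .
  qed
  show "\<exists>no. \<forall>m\<ge>no. norm ((\<Sum>j\<le>Suc m. (grid_cut l (Suc m) (Suc j) - grid_cut l (Suc m) j)
      * f (grid_node l (Suc m) j)) - integral {0..l} f) < r"
    by (intro exI[of _ N] allI impI close) simp
qed

text \<open>Cauchy-Schwarz on every step; in other words, piecewise linear interpolation does not
  increase the Dirichlet energy.\<close>

lemma grid_energy_le:
  fixes g u :: "real \<Rightarrow> real"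
  assumes l: "0 < l" "0 < n"
    and g: "\<And>a b. 0 \<le> a \<Longrightarrow> a \<le> b \<Longrightarrow> b \<le> l \<Longrightarrow> (g has_integral u b - u a) {a..b}"
    and g2: "(\<lambda>x. (g x)\<^sup>2) integrable_on {0..l}"
  shows "(\<Sum>j<n. (u (grid_node l n j) - u (grid_node l n (Suc j)))\<^sup>2 / (l / real n))
    \<le> integral {0..l} (\<lambda>x. (g x)\<^sup>2)"
proof -
  let ?p = "grid_node l n"
  have "(\<Sum>j<n. (u (?p j) - u (?p (Suc j)))\<^sup>2 / (l / real n))
      \<le> (\<Sum>j<n. integral {?p j..?p (Suc j)} (\<lambda>x. (g x)\<^sup>2))"
  proof (rule sum_mono)
    fix j assume "j \<in> {..<n}"
    then have b: "0 \<le> ?p j" "?p (Suc j) \<le> l" using grid_node_bounds[OF l] by auto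
    have d: "?p (Suc j) - ?p j = l / real n" by (simp add: grid_node_def algebra_simps add_divide_distrib)
    then have lt: "?p j < ?p (Suc j)" using l by (metis diff_gt_0_iff_gt divide_pos_pos of_nat_0_less_iff)
    have "(\<lambda>x. (g x)\<^sup>2) integrable_on {?p j..?p (Suc j)}"
      by (rule integrable_on_subinterval[OF g2]) (use b in auto)
    from has_integral_square_le[OF lt g[OF b(1) less_imp_le[OF lt] b(2)] this]
    show "(u (?p j) - u (?p (Suc j)))\<^sup>2 / (l / real n) \<le> integral {?p j..?p (Suc j)} (\<lambda>x. (g x)\<^sup>2)"
      by (simp add: d power2_commute)
  qed
  also have "\<dots> = integral {0..l} (\<lambda>x. (g x)\<^sup>2)"
    using integral_sum_partition[OF incseq_grid_node[of l n], of "\<lambda>x. (g x)\<^sup>2" n] g2 l by simp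
  finally show ?thesis .
qed

section \<open>Cheeger inequality on the grid and its continuum limit\<close>

context compact_metric_graph
begin

text \<open>Nodes are pairs of an edge and an index, so a vertex occurs once per incident edge and
  no step joins different edges. The copies are tied together only by the common value of
  \<open>u\<close>; a membership predicate on values is therefore consistent at the
  vertices.\<close>

lemma cheeger_inequality_grid:
  assumes n: "0 < n" and arcs: "arcs G \<noteq> {}"
    and vert: "\<And>e. e \<in> arcs G \<Longrightarrow> u e 0 = \<nu> (tail G e)" "\<And>e. e \<in> arcs G \<Longrightarrow> u e (len e) = \<nu> (head G e)"
    and h: "0 \<le> h" "ereal h \<le> cheeger_constant G len"
  shows "h\<^sup>2 * ((\<Sum>e\<in>arcs G. \<Sum>j\<le>n. (grid_cut (len e) n (Suc j) - grid_cut (len e) n j)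
              * (u e (grid_node (len e) n j))\<^sup>2)
        - (\<Sum>e\<in>arcs G. \<Sum>j\<le>n. (grid_cut (len e) n (Suc j) - grid_cut (len e) n j)
              * u e (grid_node (len e) n j))\<^sup>2 / (\<Sum>e\<in>arcs G. len e))
    \<le> 4 * (\<Sum>e\<in>arcs G. \<Sum>j<n. (u e (grid_node (len e) n j) - u e (grid_node (len e) n (Suc j)))\<^sup>2
              / (len e / real n))"
proof -
  define w where "w = (\<lambda>(e, j). grid_cut (len e) n (Suc j) - grid_cut (len e) n j)"
  define x where "x = (\<lambda>(e, j). u e (grid_node (len e) n j))"
  define \<delta> where "\<delta> b = len (fst b) / real n" for b :: "'e \<times> nat"
  define q where "q b = (fst b, Suc (snd b))" for b :: "'e \<times> nat"
  let ?I = "arcs G \<times> {..n}"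
  let ?B = "arcs G \<times> {..<n}"
  have cut: "incseq (grid_cut (len e) n)" if "e \<in> arcs G" for e
    by (rule incseq_grid_cut[OF len_pos[OF that] n])
  have tele: "(\<Sum>j\<le>n. grid_cut (len e) n (Suc j) - grid_cut (len e) n j) = len e" for e
    using sum_by_parts_step[of "\<lambda>j. 1" "grid_cut (len e) n" n] by simp
  have "(\<Sum>i\<in>?I. w i) = (\<Sum>e\<in>arcs G. \<Sum>j\<le>n. grid_cut (len e) n (Suc j) - grid_cut (len e) n j)"
    unfolding sum.cartesian_product by (intro sum.cong) (auto simp: w_def)
  then have W: "(\<Sum>i\<in>?I. w i) = (\<Sum>e\<in>arcs G. len e)" by (simp add: tele)
  have "h\<^sup>2 * ((\<Sum>i\<in>?I. w i * (x i)\<^sup>2) - (\<Sum>i\<in>?I. w i * x i)\<^sup>2 / (\<Sum>i\<in>?I. w i))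
    \<le> 4 * (\<Sum>b\<in>?B. (x (id b) - x (q b))\<^sup>2 / \<delta> b)"
  proof (rule discrete_cheeger)
    show "0 < \<delta> b" if "b \<in> ?B" for b
      using that n len_pos by (auto simp: \<delta>_def)
    show "0 \<le> w i" if "i \<in> ?I" for i
      using that cut by (auto simp: w_def incseq_SucD)
    show "0 < (\<Sum>i\<in>?I. w i)"
      unfolding W using arcs len_pos by (intro sum_pos) auto
    show "(\<Sum>b\<in>?B. \<delta> b * (f (id b) + f (q b))) = 2 * (\<Sum>i\<in>?I. w i * f i)" for f
    proof -
      have "(\<Sum>b\<in>?B. \<delta> b * (f (id b) + f (q b)))
          = (\<Sum>e\<in>arcs G. \<Sum>j<n. len e / real n * (f (e, j) + f (e, Suc j)))"
        unfolding sum.cartesian_product by (intro sum.cong) (auto simp: \<delta>_def q_def)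
      also have "\<dots> = (\<Sum>e\<in>arcs G. 2 * (\<Sum>j\<le>n. (grid_cut (len e) n (Suc j) - grid_cut (len e) n j) * f (e, j)))"
        by (intro sum.cong grid_trapezoid len_pos n) auto
      also have "\<dots> = 2 * (\<Sum>i\<in>?I. w i * f i)"
        unfolding sum_distrib_left[symmetric] sum.cartesian_product
        by (intro arg_cong2[where f = "(*)"] sum.cong) (auto simp: w_def)
      finally show ?thesis .
    qed
    fix \<phi> :: "real \<Rightarrow> bool"
    define \<kappa> where "\<kappa> e j = \<phi> (u e (grid_node (len e) n j))" for e j
    have m: "(\<Sum>i\<in>?I. w i * of_bool (\<phi> (x i)))
        = (\<Sum>e\<in>arcs G. \<Sum>j\<le>n. (grid_cut (len e) n (Suc j) - grid_cut (len e) n j) * of_bool (\<kappa> e j))"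
      unfolding sum.cartesian_product by (intro sum.cong) (auto simp: w_def x_def \<kappa>_def)
    assume "(\<Sum>i\<in>?I. w i * of_bool (\<phi> (x i))) \<le> (\<Sum>i\<in>?I. w i) / 2"
    then have half: "(\<Sum>e\<in>arcs G. \<Sum>j\<le>n. (grid_cut (len e) n (Suc j) - grid_cut (len e) n j) * of_bool (\<kappa> e j))
        \<le> (\<Sum>e\<in>arcs G. len e) / 2" unfolding m W .
    have "h * (\<Sum>i\<in>?I. w i * of_bool (\<phi> (x i)))
        \<le> (\<Sum>e\<in>arcs G. \<Sum>j<n. \<bar>of_bool (\<kappa> e j) - of_bool (\<kappa> e (Suc j))\<bar>)"
      unfolding m
      by (rule cheeger_constant_cell_union[where \<nu> = "\<lambda>v. \<phi> (\<nu> v)", OF _ _ _ _ _ _ h(2) half])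
        (use cut vert grid_cut_inner(2) len_pos n in \<open>auto simp: \<kappa>_def\<close>)
    also have "\<dots> = (\<Sum>b\<in>?B. \<bar>of_bool (\<phi> (x (id b))) - of_bool (\<phi> (x (q b)))\<bar>)"
      unfolding sum.cartesian_product by (intro sum.cong) (auto simp: x_def q_def \<kappa>_def)
    finally show "h * (\<Sum>i\<in>?I. w i * of_bool (\<phi> (x i)))
        \<le> (\<Sum>b\<in>?B. \<bar>of_bool (\<phi> (x (id b))) - of_bool (\<phi> (x (q b)))\<bar>)" .
  qed (use h in \<open>auto simp: q_def\<close>)
  also have "(\<Sum>b\<in>?B. (x (id b) - x (q b))\<^sup>2 / \<delta> b)
      = (\<Sum>e\<in>arcs G. \<Sum>j<n. (u e (grid_node (len e) n j) - u e (grid_node (len e) n (Suc j)))\<^sup>2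
              / (len e / real n))"
    unfolding sum.cartesian_product by (intro sum.cong) (auto simp: x_def q_def \<delta>_def)
  also have "(\<Sum>i\<in>?I. w i * (x i)\<^sup>2) = (\<Sum>e\<in>arcs G. \<Sum>j\<le>n.
      (grid_cut (len e) n (Suc j) - grid_cut (len e) n j) * (u e (grid_node (len e) n j))\<^sup>2)"
    unfolding sum.cartesian_product by (intro sum.cong) (auto simp: x_def w_def)
  also have "(\<Sum>i\<in>?I. w i * x i) = (\<Sum>e\<in>arcs G. \<Sum>j\<le>n.
      (grid_cut (len e) n (Suc j) - grid_cut (len e) n j) * u e (grid_node (len e) n j))"
    unfolding sum.cartesian_product by (intro sum.cong) (auto simp: x_def w_def)
  finally show ?thesis unfolding W .
qed

text \<open>Stated for any integral density \<open>g\<close> of \<open>u\<close>, so that it applies both to the weak derivative and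
  to the classical derivative of an eigenfunction.\<close>

lemma cheeger_inequality_energy:
  assumes u: "\<And>e. e \<in> arcs G \<Longrightarrow> continuous_on {0..len e} (u e)"
    and vert: "continuous_at_vertices G len u"
    and g: "\<And>e a b. e \<in> arcs G \<Longrightarrow> 0 \<le> a \<Longrightarrow> a \<le> b \<Longrightarrow> b \<le> len e \<Longrightarrow>
      (g e has_integral u e b - u e a) {a..b}"
    and g2: "\<And>e. e \<in> arcs G \<Longrightarrow> (\<lambda>x. (g e x)\<^sup>2) integrable_on {0..len e}"
    and mean: "(\<Sum>e\<in>arcs G. integral {0..len e} (u e)) = 0"
    and h: "0 \<le> h" "ereal h \<le> cheeger_constant G len"
  shows "h\<^sup>2 * (\<Sum>e\<in>arcs G. integral {0..len e} (\<lambda>x. (u e x)\<^sup>2))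
    \<le> 4 * (\<Sum>e\<in>arcs G. integral {0..len e} (\<lambda>x. (g e x)\<^sup>2))"
proof (cases "arcs G = {}")
  case True
  then show ?thesis by simp
next
  case False
  obtain \<nu> where \<nu>: "\<And>e. e \<in> arcs G \<Longrightarrow> u e 0 = \<nu> (tail G e)"
      "\<And>e. e \<in> arcs G \<Longrightarrow> u e (len e) = \<nu> (head G e)"
    using continuous_at_vertices_imp_vertex_function[OF vert] by blast
  let ?E = "\<Sum>e\<in>arcs G. integral {0..len e} (\<lambda>x. (g e x)\<^sup>2)"
  define W where "W = (\<Sum>e\<in>arcs G. len e)"
  define S where "S m f = (\<Sum>e\<in>arcs G. \<Sum>j\<le>Suc m.
      (grid_cut (len e) (Suc m) (Suc j) - grid_cut (len e) (Suc m) j) * f (u e (grid_node (len e) (Suc m) j)))"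
    for m and f :: "real \<Rightarrow> real"
  have le: "h\<^sup>2 * (S m (\<lambda>t. t\<^sup>2) - (S m (\<lambda>t. t))\<^sup>2 / W) \<le> 4 * ?E" for m
  proof -
    have "h\<^sup>2 * (S m (\<lambda>t. t\<^sup>2) - (S m (\<lambda>t. t))\<^sup>2 / W)
        \<le> 4 * (\<Sum>e\<in>arcs G. \<Sum>j<Suc m. (u e (grid_node (len e) (Suc m) j)
            - u e (grid_node (len e) (Suc m) (Suc j)))\<^sup>2 / (len e / real (Suc m)))"
      unfolding S_def W_def by (rule cheeger_inequality_grid[OF _ False \<nu> h]) simp
    also have "\<dots> \<le> 4 * ?E"
      by (intro mult_left_mono sum_mono grid_energy_le len_pos g g2) auto
    finally show ?thesis .
  qed
  have lim: "(\<lambda>m. S m f) \<longlonglongrightarrow> (\<Sum>e\<in>arcs G. integral {0..len e} (\<lambda>x. f (u e x)))"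
    if f: "continuous_on UNIV f" for f
    unfolding S_def
  proof (rule tendsto_sum)
    fix e assume e: "e \<in> arcs G"
    have "continuous_on {0..len e} (\<lambda>x. f (u e x))"
      by (rule continuous_on_compose2[OF f u[OF e]]) auto
    from grid_riemann_sum_tendsto[OF len_pos[OF e] this]
    show "(\<lambda>m. \<Sum>j\<le>Suc m. (grid_cut (len e) (Suc m) (Suc j) - grid_cut (len e) (Suc m) j)
        * f (u e (grid_node (len e) (Suc m) j))) \<longlonglongrightarrow> integral {0..len e} (\<lambda>x. f (u e x))" .
  qed
  \<comment> \<open>The Riemann sums of \<open>u\<close> vanish only in the limit, where
    \<open>mean\<close> removes the subtracted square.\<close>
  have "(\<lambda>m. h\<^sup>2 * (S m (\<lambda>t. t\<^sup>2) - (S m (\<lambda>t. t))\<^sup>2 / W)) \<longlonglongrightarrow>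
      h\<^sup>2 * ((\<Sum>e\<in>arcs G. integral {0..len e} (\<lambda>x. (u e x)\<^sup>2))
        - (\<Sum>e\<in>arcs G. integral {0..len e} (\<lambda>x. u e x))\<^sup>2 / W)"
    unfolding divide_inverse
    by (intro tendsto_mult tendsto_diff tendsto_power tendsto_const lim continuous_intros)
  from LIMSEQ_le_const2[OF this] le mean show ?thesis by simp
qed

end

section \<open>Eigenfunctions\<close>

text \<open>Subtracting the linear interpolant leaves an additive \<open>P\<close> with
  \<open>P l = 0\<close>, hence odd under reflection at \<open>l / 2\<close>. At a maximum point,
  doubling the argument, or in the right half doubling the distance from \<open>l\<close>, doubles
  the value. So the maximum is at most 0, and the reflection excludes negative values.\<close>

lemma continuous_additive_imp_linear:
  fixes K :: "real \<Rightarrow> real"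
  assumes l: "0 < l" and K: "continuous_on {0..l} K"
    and add: "\<And>x y. 0 \<le> x \<Longrightarrow> 0 \<le> y \<Longrightarrow> x + y \<le> l \<Longrightarrow> K (x + y) = K x + K y"
    and x: "x \<in> {0..l}"
  shows "K x = K l / l * x"
proof -
  define P where "P x = K x - K l / l * x" for x
  have P: "P (x + y) = P x + P y" if "0 \<le> x" "0 \<le> y" "x + y \<le> l" for x y
    using add[OF that] by (simp add: P_def algebra_simps add_divide_distrib)
  have Pl: "P l = 0" using l by (simp add: P_def)
  have reflect: "P (l - y) = - P y" if "y \<in> {0..l}" for y
    using P[of "l - y" y] that Pl by simp
  have "continuous_on {0..l} P" unfolding P_def by (intro continuous_intros K)
  then obtain x0 where x0: "x0 \<in> {0..l}" and max: "\<And>y. y \<in> {0..l} \<Longrightarrow> P y \<le> P x0"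
    using continuous_attains_sup[of "{0..l}" P] l by auto
  have "P x0 \<le> 0"
  proof (cases "x0 \<le> l / 2")
    case True
    then show ?thesis using P[of x0 x0] max[of "x0 + x0"] x0 by simp
  next
    case False
    define y where "y = l - x0"
    have y: "0 \<le> y" "y + y \<le> l" using False x0 by (auto simp: y_def)
    have "P (l - (y + y)) = 2 * P x0"
      using reflect[of "y + y"] reflect[OF x0] P[of y y] y by (simp add: y_def)
    then show ?thesis using max[of "l - (y + y)"] y by simp
  qed
  with max have le: "P y \<le> 0" if "y \<in> {0..l}" for y using that by force
  have "P x = 0" using le[OF x] le[of "l - x"] reflect[OF x] x by simp
  then show ?thesis by (simp add: P_def)
qed

text \<open>With \<open>g = 0\<close>, \<open>weak_deriv_hat\<close> says that integrals over
  windows of equal length do not depend on the position, so the primitive is additive. The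
  conclusion concerns the primitive because \<open>f\<close> is determined only up to null
  sets.\<close>

lemma weak_deriv_zero_integral:
  fixes f :: "real \<Rightarrow> real"
  assumes l: "0 < l" and f: "integrable (edge_measure l) f" and w: "has_weak_deriv l f (\<lambda>x. 0)"
  shows "\<exists>c. \<forall>x\<in>{0..l}. integral {0..x} f = c * x"
proof -
  define K where "K x = integral {0..x} f" for x
  have fi: "f integrable_on {0..l}"
    using f unfolding edge_integrable_iff by (rule set_lebesgue_integral_eq_integral)
  have K: "continuous_on {0..l} K"
    unfolding K_def by (rule indefinite_integral_continuous_1[OF fi])
  have diff: "integral {r..s} f = K s - K r" if "0 \<le> r" "r \<le> s" "s \<le> l" for r s
  proof -
    have "f integrable_on {0..s}" by (rule integrable_on_subinterval[OF fi]) (use that in auto)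
    from Henstock_Kurzweil_Integration.integral_combine[OF that(1,2) this] show ?thesis by (simp add: K_def)
  qed
  have "K (x + y) = K x + K y" if xy: "0 \<le> x" "0 \<le> y" "x + y \<le> l" for x y
  proof (cases "y = 0")
    case True
    then show ?thesis by (simp add: K_def)
  next
    case False
    \<comment> \<open>The windows starting at 0 and \<open>y\<close> are moved inwards by
      \<open>t\<close>, since \<open>weak_deriv_hat\<close> asks for windows inside the open edge;
      continuity in \<open>t\<close> then gives the case \<open>t = 0\<close>.\<close>
    define M where "M t = (K (t + x) - K t) - (K (y - t + x) - K (y - t))" for t
    have "M 0 = 0"
    proof (rule continuous_constant_on_closure[where S = "{0<..<y / 2}" and f = M and x = 0])
      have "continuous_on {0..y / 2} M"
        unfolding M_def using xy by (intro continuous_intros continuous_on_compose2[OF K]) auto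
      then show "continuous_on (closure {0<..<y / 2}) M" using False xy by simp
      show "M t = 0" if "t \<in> {0<..<y / 2}" for t
        using weak_deriv_hat[OF f _ w, of t "y - t" x] that xy
        by (simp add: M_def diff)
      show "0 \<in> closure {0<..<y / 2}" using False xy by simp
    qed
    then show ?thesis by (simp add: M_def K_def add.commute)
  qed
  from continuous_additive_imp_linear[OF l K this] show ?thesis unfolding K_def by blast
qed

lemma test_functionD:
  assumes "test_function l \<phi>" "0 < l"
  shows "\<And>x. (\<phi> has_real_derivative deriv \<phi> x) (at x)" "continuous_on UNIV (deriv \<phi>)"
    "continuous_on UNIV \<phi>" "\<phi> 0 = 0" "\<phi> l = 0"
proof -
  obtain K where K: "K \<subseteq> {0<..<l}" "\<And>x. x \<notin> K \<Longrightarrow> \<phi> x = 0"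
    using assms(1) unfolding test_function_def by blast
  have "0 \<notin> K" "l \<notin> K" using K(1) by auto
  then show "\<phi> 0 = 0" "\<phi> l = 0" using K(2) by auto
  obtain D where D: "\<And>x. (\<phi> has_real_derivative D x) (at x)" "continuous_on UNIV D"
    using assms(1) unfolding test_function_def C1_differentiable_on_def
    by (auto simp: has_real_derivative_iff_has_vector_derivative)
  then have "deriv \<phi> = D" by (intro ext DERIV_imp_deriv)
  with D show "\<And>x. (\<phi> has_real_derivative deriv \<phi> x) (at x)" "continuous_on UNIV (deriv \<phi>)"
    by auto
  show "continuous_on UNIV \<phi>"
    using D(1) by (intro DERIV_continuous_on) (auto intro: has_field_derivative_at_within)
qed

lemma has_weak_deriv_indefinite_integral:
  fixes v :: "real \<Rightarrow> real"
  assumes l: "0 < l" and v: "continuous_on {0..l} v"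
  shows "has_weak_deriv l (\<lambda>x. integral {0..x} v) v"
  unfolding has_weak_deriv_def
proof (intro allI impI)
  fix \<phi> assume "test_function l \<phi>"
  note \<phi> = test_functionD[OF this l]
  define V where "V x = integral {0..x} v" for x
  have V: "(V has_real_derivative v x) (at x within {0..l})" if "x \<in> {0..l}" for x
    unfolding V_def by (rule integral_has_real_derivative[OF v that])
  then have Vc: "continuous_on {0..l} V" by (rule DERIV_continuous_on)
  have c: "continuous_on {0..l} (\<lambda>x. V x * deriv \<phi> x)" "continuous_on {0..l} (\<lambda>x. v x * \<phi> x)"
    by (intro continuous_on_mult Vc v continuous_on_subset[OF \<phi>(2)] continuous_on_subset[OF \<phi>(3)]; simp)+
  have "((\<lambda>x. V x * deriv \<phi> x + v x * \<phi> x) has_integral V l * \<phi> l - V 0 * \<phi> 0) {0..l}"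
  proof (rule fundamental_theorem_of_calculus)
    fix x assume "x \<in> {0..l}"
    then have "((\<lambda>x. V x * \<phi> x) has_real_derivative V x * deriv \<phi> x + v x * \<phi> x) (at x within {0..l})"
      using DERIV_mult[OF V has_field_derivative_at_within[OF \<phi>(1)]] by (simp add: add.commute mult.commute)
    then show "((\<lambda>x. V x * \<phi> x) has_vector_derivative V x * deriv \<phi> x + v x * \<phi> x) (at x within {0..l})"
      by (simp add: has_real_derivative_iff_has_vector_derivative)
  qed (use l in simp)
  then have "0 = integral {0..l} (\<lambda>x. V x * deriv \<phi> x + v x * \<phi> x)"
    using \<phi>(4,5) by (simp add: integral_unique)
  also have "\<dots> = integral {0..l} (\<lambda>x. V x * deriv \<phi> x) + integral {0..l} (\<lambda>x. v x * \<phi> x)"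
    by (intro Henstock_Kurzweil_Integration.integral_add integrable_continuous_real c)
  finally show "(LINT x|edge_measure l. integral {0..x} v * deriv \<phi> x)
      = - (LINT x|edge_measure l. v x * \<phi> x)"
    unfolding V_def[symmetric] by (simp add: edge_integral_eq edge_integrable_continuous c)
qed

text \<open>\<open>g\<close> minus a primitive \<open>V\<close> of \<open>v\<close> has weak
  derivative 0, so its integral is linear with some slope \<open>c\<close>. Integrating
  \<open>g\<close> back to \<open>u\<close> shows that \<open>c + V\<close> is the classical
  derivative of \<open>u\<close>, one-sided at the endpoints.\<close>

lemma weak_deriv_twice_continuous:
  fixes u g v :: "real \<Rightarrow> real"
  assumes l: "0 < l" and u: "continuous_on {0..l} u" and g: "integrable (edge_measure l) g"
    and ug: "has_weak_deriv l u g" and v: "continuous_on {0..l} v" and gv: "has_weak_deriv l g v"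
  shows "\<exists>\<psi>. \<forall>x\<in>{0..l}. (u has_real_derivative \<psi> x) (at x within {0..l})
      \<and> (\<psi> has_real_derivative v x) (at x within {0..l})"
proof -
  define V where "V x = integral {0..x} v" for x
  have V: "(V has_real_derivative v x) (at x within {0..l})" if "x \<in> {0..l}" for x
    unfolding V_def by (rule integral_has_real_derivative[OF v that])
  then have Vc: "continuous_on {0..l} V" by (rule DERIV_continuous_on)
  have Vi: "integrable (edge_measure l) V" by (rule edge_integrable_continuous[OF Vc])
  have "has_weak_deriv l (\<lambda>x. g x - V x) (\<lambda>x. 0)"
    unfolding has_weak_deriv_def
  proof (intro allI impI)
    fix \<phi> assume test: "test_function l \<phi>"
    note \<phi> = test_functionD[OF test l]
    have c: "continuous_on {0..l} (deriv \<phi>)" by (rule continuous_on_subset[OF \<phi>(2)]) simp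
    then have "bounded (deriv \<phi> ` {0..l})"
      by (intro compact_imp_bounded compact_continuous_image) auto
    then obtain C where "\<forall>x\<in>{0..l}. \<bar>deriv \<phi> x\<bar> \<le> C"
      unfolding bounded_iff by auto
    then have C: "\<bar>deriv \<phi> x\<bar> \<le> C" if "x \<in> {0..l}" for x using that by blast
    \<comment> \<open>\<open>edge_integrable_mult_bounded\<close> asks for a bound on the whole
      line; the clamped function has one and agrees with \<open>deriv \<phi>\<close> on the
      edge.\<close>
    define d where "d x = max (- C) (min C (deriv \<phi> x))" for x
    have d: "d x = deriv \<phi> x" if "x \<in> {0..l}" for x using C[OF that] by (auto simp: d_def)
    have "continuous_on UNIV d" unfolding d_def by (intro continuous_intros \<phi>(2))
    then have dm: "d \<in> borel_measurable borel" by (rule borel_measurable_continuous_onI)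
    have "0 \<le> C" using C[of 0] l by auto
    then have dC: "\<bar>d x\<bar> \<le> C" for x by (auto simp: d_def)
    have dd: "(LINT x|edge_measure l. f x * deriv \<phi> x) = (LINT x|edge_measure l. f x * d x)" for f
      by (rule Bochner_Integration.integral_cong) (auto simp: d)
    have "(LINT x|edge_measure l. (g x - V x) * deriv \<phi> x) = (LINT x|edge_measure l. (g x - V x) * d x)"
      by (rule dd)
    also have "\<dots> = (LINT x|edge_measure l. g x * d x) - (LINT x|edge_measure l. V x * d x)"
      unfolding left_diff_distrib
      by (intro Bochner_Integration.integral_diff edge_integrable_mult_bounded[OF _ dm dC] g Vi)
    also have "\<dots> = 0"
      using trans[OF dd[symmetric] gv[unfolded has_weak_deriv_def, rule_format, OF test]]
        trans[OF dd[symmetric] has_weak_deriv_indefinite_integral[OF l v, folded V_def,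
          unfolded has_weak_deriv_def, rule_format, OF test]] by simp
    finally show "(LINT x|edge_measure l. (g x - V x) * deriv \<phi> x)
        = - (LINT x|edge_measure l. 0 * \<phi> x)" by simp
  qed
  from weak_deriv_zero_integral[OF l Bochner_Integration.integrable_diff[OF g Vi] this]
  obtain c where c: "\<And>x. x \<in> {0..l} \<Longrightarrow> integral {0..x} (\<lambda>x. g x - V x) = c * x"
    by blast
  have "u x = u 0 + c * x + integral {0..x} V" if x: "x \<in> {0..l}" for x
  proof -
    have "(g has_integral u x - u 0) {0..x}"
      by (rule weak_deriv_has_integral[OF u g ug]) (use x in auto)
    moreover have "(V has_integral integral {0..x} V) {0..x}"
      using x by (intro integrable_integral integrable_continuous_real continuous_on_subset[OF Vc]) auto
    ultimately have "((\<lambda>x. g x - V x) has_integral u x - u 0 - integral {0..x} V) {0..x}"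
      by (rule has_integral_diff)
    then show ?thesis using c[OF x] by (simp add: integral_unique)
  qed
  note u_eq = this
  have D: "(u has_real_derivative c + V x) (at x within {0..l})
      \<and> ((\<lambda>x. c + V x) has_real_derivative v x) (at x within {0..l})" if x: "x \<in> {0..l}" for x
  proof
    have "((\<lambda>x. u 0 + c * x) has_real_derivative c) (at x within {0..l})"
      by (auto intro!: derivative_eq_intros)
    from DERIV_add[OF this integral_has_real_derivative[OF Vc x]]
    have "((\<lambda>x. u 0 + c * x + integral {0..x} V) has_real_derivative c + V x) (at x within {0..l})" .
    then show "(u has_real_derivative c + V x) (at x within {0..l})"
      by (rule has_field_derivative_transform_within[where d = 1, OF _ _ x u_eq[symmetric]]) simp
    show "((\<lambda>x. c + V x) has_real_derivative v x) (at x within {0..l})"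
      using DERIV_add[OF DERIV_const V[OF x]] by simp
  qed
  show ?thesis by (intro exI[of _ "\<lambda>x. c + V x"] ballI D)
qed

lemma has_weak_deriv_cong_AE:
  assumes l: "0 < l" and fg: "has_weak_deriv l f g" and g: "integrable (edge_measure l) g"
    and g': "integrable (edge_measure l) g'" and ae: "AE x in edge_measure l. g x = g' x"
  shows "has_weak_deriv l f g'"
  unfolding has_weak_deriv_def
proof (intro allI impI)
  fix \<phi> assume test: "test_function l \<phi>"
  have "\<phi> \<in> borel_measurable (edge_measure l)"
    using test_functionD(3)[OF test l]
    by (intro borel_measurable_edge borel_measurable_continuous_onI)
  with g g' ae have "(LINT x|edge_measure l. g x * \<phi> x) = (LINT x|edge_measure l. g' x * \<phi> x)"
    by (intro integral_cong_AE) (auto intro: borel_measurable_integrable)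
  with fg test show "(LINT x|edge_measure l. f x * deriv \<phi> x) = - (LINT x|edge_measure l. g' x * \<phi> x)"
    unfolding has_weak_deriv_def by simp
qed

text \<open>This translates the Kirchhoff condition, given by limits of \<open>deriv u\<close> from
  inside the edge, into endpoint values of the continuous \<open>\<psi>\<close>.\<close>

lemma deriv_one_sided_limits:
  fixes u \<psi> :: "real \<Rightarrow> real"
  assumes l: "0 < l" and \<psi>: "continuous_on {0..l} \<psi>"
    and u: "\<And>x. x \<in> {0..l} \<Longrightarrow> (u has_real_derivative \<psi> x) (at x within {0..l})"
  shows "Lim (at_left l) (deriv u) = \<psi> l" "Lim (at_right 0) (deriv u) = \<psi> 0"
proof -
  have d: "\<psi> x = deriv u x" if "0 < x" "x < l" for x
    using u[of x] that by (intro DERIV_imp_deriv[symmetric]) (simp add: at_within_Icc_at)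
  have "(\<psi> \<longlongrightarrow> \<psi> l) (at_left l)" by (rule continuous_on_Icc_at_leftD[OF \<psi> l])
  moreover have "\<forall>\<^sub>F x in at_left l. \<psi> x = deriv u x"
    unfolding eventually_at_left_field using l d by blast
  ultimately have "(deriv u \<longlongrightarrow> \<psi> l) (at_left l)" by (rule Lim_transform_eventually)
  then show "Lim (at_left l) (deriv u) = \<psi> l" by (intro tendsto_Lim) simp_all
  have "(\<psi> \<longlongrightarrow> \<psi> 0) (at_right 0)" by (rule continuous_on_Icc_at_rightD[OF \<psi> l])
  moreover have "\<forall>\<^sub>F x in at_right 0. \<psi> x = deriv u x"
    unfolding eventually_at_right_field using l d by blast
  ultimately have "(deriv u \<longlongrightarrow> \<psi> 0) (at_right 0)" by (rule Lim_transform_eventually)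
  then show "Lim (at_right 0) (deriv u) = \<psi> 0" by (intro tendsto_Lim) simp_all
qed

text \<open>Reduces the extended-real claim to finite \<open>h\<close>. An infinite \<open>H\<close>
  would admit arbitrarily large \<open>h\<close>, whose squares no real \<open>4 * q\<close> can
  bound.\<close>

lemma quarter_square_le_ereal:
  assumes "0 \<le> H" and h: "\<And>h. 0 \<le> h \<Longrightarrow> ereal h \<le> H \<Longrightarrow> h\<^sup>2 \<le> 4 * q"
  shows "ereal (1/4) * H\<^sup>2 \<le> ereal q"
proof (cases H)
  case (real r)
  then have "r\<^sup>2 \<le> 4 * q" using h[of r] assms(1) by simp
  with real show ?thesis by simp
next
  case PInf
  \<comment> \<open>Taking \<open>h = 2 * s\<close> gives \<open>s * s \<le> q\<close>, which
    contradicts \<open>s \<ge> 1\<close> and \<open>s > q\<close>.\<close>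
  define s where "s = \<bar>q\<bar> + 1"
  have s: "1 \<le> s" "q < s" by (auto simp: s_def)
  have "(2 * s)\<^sup>2 \<le> 4 * q" using h[of "2 * s"] PInf s by simp
  then have "s * s \<le> q" by (simp add: power2_eq_square)
  moreover have "1 * s \<le> s * s" using s by (intro mult_right_mono) auto
  ultimately have False using s by linarith
  then show ?thesis ..
next
  case MInf
  with assms(1) show ?thesis by simp
qed

section \<open>Bounds for the spectral gap and for nonzero eigenvalues\<close>

context compact_metric_graph
begin

lemma cheeger_constant_nonneg: "0 \<le> cheeger_constant G len"
  unfolding cheeger_constant_def
proof (rule INF_greatest)
  fix D assume D: "D \<in> {D. measurable_subset G len D \<and> 0 < graph_length G len D \<and>
                 graph_length G len D \<le> 1/2 * graph_length G len (whole_graph len)}"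
  \<comment> \<open>The zero field is admissible, so the supremum defining the perimeter is at least
    0.\<close>
  define z where "z = (\<lambda>(e::'e) (x::real). 0::real)"
  have "(\<lambda>x. 0) \<in> W12_interval l" for l
    unfolding W12_interval_def mem_Collect_eq
    by (intro conjI exI[of _ "\<lambda>x. 0"] square_integrable_continuous)
      (auto simp: has_weak_deriv_def)
  then have "z \<in> {z \<in> X_K G len. Linf_norm_le_1 G len z}"
    by (auto simp: X_K_def W12_def Linf_norm_le_1_def signed_vertex_value_def z_def intro!: sum.neutral)
  then have "0 \<le> perimeter G len D"
    unfolding perimeter_def total_variation_def by (rule SUP_upper2) simp
  with D show "0 \<le> perimeter G len D / ereal (graph_length G len D)" by simp
qed

lemma L2_norm_square:
  assumes "\<And>e. e \<in> arcs G \<Longrightarrow> continuous_on {0..len e} (u e)"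
  shows "(L2_norm G len u)\<^sup>2 = (\<Sum>e\<in>arcs G. integral {0..len e} (\<lambda>x. (u e x)\<^sup>2))"
proof -
  have "graph_integral G len (\<lambda>e x. (u e x)\<^sup>2) = (\<Sum>e\<in>arcs G. integral {0..len e} (\<lambda>x. (u e x)\<^sup>2))"
    unfolding graph_integral_def
    by (intro sum.cong edge_integral_eq edge_integrable_continuous continuous_on_power assms) auto
  moreover have "0 \<le> graph_integral G len (\<lambda>e x. (u e x)\<^sup>2)"
    unfolding graph_integral_def by (intro sum_nonneg Bochner_Integration.integral_nonneg) simp
  ultimately show ?thesis by (simp add: L2_norm_def)
qed

text \<open>Each competitor in the infimum is treated on its own, with its weak derivative as the
  density in \<open>cheeger_inequality_energy\<close>.\<close>

lemma cheeger_le_spectral_gap: "ereal (1/4) * (cheeger_constant G len)\<^sup>2 \<le> spectral_gap G len"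
  unfolding spectral_gap_def
proof (rule INF_greatest, rule quarter_square_le_ereal[OF cheeger_constant_nonneg])
  fix u h
  assume "u \<in> {u \<in> energy_domain G len. L2_norm G len u \<noteq> 0 \<and> graph_integral G len u = 0}"
  then have W: "\<And>e. e \<in> arcs G \<Longrightarrow> u e \<in> W12_interval (len e)"
    and u: "\<And>e. e \<in> arcs G \<Longrightarrow> continuous_on {0..len e} (u e)"
    and vert: "continuous_at_vertices G len u" and norm: "L2_norm G len u \<noteq> 0"
    and mean: "graph_integral G len u = 0"
    by (auto simp: energy_domain_def W12_def)
  assume h: "0 \<le> h" "ereal h \<le> cheeger_constant G len"
  let ?g = "edge_deriv len u"
  have sq: "square_integrable (len e) (?g e)" and wd: "has_weak_deriv (len e) (u e) (?g e)"
    if "e \<in> arcs G" for e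
    using weak_deriv_props[OF W[OF that]] by (simp_all add: edge_deriv_def)
  have "h\<^sup>2 * (\<Sum>e\<in>arcs G. integral {0..len e} (\<lambda>x. (u e x)\<^sup>2))
      \<le> 4 * (\<Sum>e\<in>arcs G. integral {0..len e} (\<lambda>x. (?g e x)\<^sup>2))"
  proof (rule cheeger_inequality_energy[OF u vert _ _ _ h])
    show "(?g e has_integral u e b - u e a) {a..b}"
      if "e \<in> arcs G" "0 \<le> a" "a \<le> b" "b \<le> len e" for e a b
      using that by (intro weak_deriv_has_integral[OF u square_integrable_imp_integrable[OF sq] wd])
    show "(\<lambda>x. (?g e x)\<^sup>2) integrable_on {0..len e}" if "e \<in> arcs G" for e
      using sq[OF that] unfolding square_integrable_def edge_integrable_iff
      by (auto intro: set_lebesgue_integral_eq_integral)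
    have "graph_integral G len u = (\<Sum>e\<in>arcs G. integral {0..len e} (u e))"
      unfolding graph_integral_def
      by (intro sum.cong edge_integral_eq edge_integrable_continuous u) auto
    with mean show "(\<Sum>e\<in>arcs G. integral {0..len e} (u e)) = 0" by simp
  qed
  moreover have "energy G len u = (\<Sum>e\<in>arcs G. integral {0..len e} (\<lambda>x. (?g e x)\<^sup>2))"
    unfolding energy_def graph_integral_def
    using sq by (intro sum.cong edge_integral_eq) (auto simp: square_integrable_def)
  ultimately have "h\<^sup>2 * (L2_norm G len u)\<^sup>2 \<le> 4 * energy G len u"
    by (simp add: L2_norm_square[OF u])
  with norm show "h\<^sup>2 \<le> 4 * (energy G len u / (L2_norm G len u)\<^sup>2)"
    by (simp add: pos_le_divide_eq)
qed

text \<open>The eigenvalue equation holds only almost everywhere, but its right-hand side is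
  continuous. Hence \<open>- \<mu> * u e\<close> is a continuous weak derivative of
  \<open>edge_deriv len u e\<close>, and \<open>weak_deriv_twice_continuous\<close> applies.\<close>

lemma eigenfunction_classical:
  assumes u: "u \<in> laplacian_domain G len" and e: "e \<in> arcs G"
    and eig: "AE x in edge_measure (len e). - laplacian len u e x = \<mu> * u e x"
  shows "\<exists>\<psi>. \<forall>x\<in>{0..len e}. (u e has_real_derivative \<psi> x) (at x within {0..len e})
      \<and> (\<psi> has_real_derivative - \<mu> * u e x) (at x within {0..len e})"
proof -
  have W: "u e \<in> W12_interval (len e)" "edge_deriv len u e \<in> W12_interval (len e)"
    and uc: "continuous_on {0..len e} (u e)"
    using u e by (auto simp: laplacian_domain_def W22_def W12_def)
  note g = weak_deriv_props[OF W(1), folded edge_deriv_def]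
  have g2: "square_integrable (len e) (laplacian len u e)"
      "has_weak_deriv (len e) (edge_deriv len u e) (laplacian len u e)"
    using weak_deriv_props[OF W(2)] unfolding laplacian_def edge_deriv_def[of len "edge_deriv len u"] .
  have vc: "continuous_on {0..len e} (\<lambda>x. - \<mu> * u e x)" by (intro continuous_intros uc)
  have "AE x in edge_measure (len e). laplacian len u e x = - \<mu> * u e x"
    using eig by (rule eventually_mono) auto
  then have "has_weak_deriv (len e) (edge_deriv len u e) (\<lambda>x. - \<mu> * u e x)"
    by (intro has_weak_deriv_cong_AE[OF len_pos[OF e] g2(2)] square_integrable_imp_integrable[OF g2(1)]
        edge_integrable_continuous[OF vc])
  then show ?thesis
    by (rule weak_deriv_twice_continuous[OF len_pos[OF e] uc square_integrable_imp_integrable[OF g(1)] g(2) vc])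
qed

lemma cheeger_le_eigenvalue:
  assumes "neg_laplacian_eigenvalue G len \<mu>" "\<mu> \<noteq> 0"
  shows "ereal (1/4) * (cheeger_constant G len)\<^sup>2 \<le> ereal \<mu>"
proof (rule quarter_square_le_ereal[OF cheeger_constant_nonneg])
  fix h assume h: "0 \<le> h" "ereal h \<le> cheeger_constant G len"
  obtain u where dom: "u \<in> laplacian_domain G len" and norm: "L2_norm G len u \<noteq> 0"
    and eig: "\<And>e. e \<in> arcs G \<Longrightarrow> AE x in edge_measure (len e). - laplacian len u e x = \<mu> * u e x"
    using assms(1) unfolding neg_laplacian_eigenvalue_def by blast
  have u: "\<And>e. e \<in> arcs G \<Longrightarrow> continuous_on {0..len e} (u e)"
    and vert: "continuous_at_vertices G len u"
    and kirchhoff: "\<And>v. v \<in> verts G \<Longrightarrow> (\<Sum>e\<in>incident_edges G v. normal_deriv G len u e v) = 0"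
    using dom by (auto simp: laplacian_domain_def W22_def W12_def)
  have "\<forall>e\<in>arcs G. \<exists>\<psi>. \<forall>x\<in>{0..len e}. (u e has_real_derivative \<psi> x) (at x within {0..len e})
      \<and> (\<psi> has_real_derivative - \<mu> * u e x) (at x within {0..len e})"
    using eigenfunction_classical[OF dom _ eig] by blast
  then obtain \<psi> where \<psi>:
      "\<And>e x. e \<in> arcs G \<Longrightarrow> x \<in> {0..len e} \<Longrightarrow> (u e has_real_derivative \<psi> e x) (at x within {0..len e})"
      "\<And>e x. e \<in> arcs G \<Longrightarrow> x \<in> {0..len e} \<Longrightarrow> (\<psi> e has_real_derivative - \<mu> * u e x) (at x within {0..len e})"
    by (subst (asm) bchoice_iff) blast
  have \<psi>c: "continuous_on {0..len e} (\<psi> e)" if "e \<in> arcs G" for e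
    by (rule DERIV_continuous_on[OF \<psi>(2)[OF that]])
  obtain \<nu> where \<nu>: "\<And>e. e \<in> arcs G \<Longrightarrow> u e 0 = \<nu> (tail G e)"
      "\<And>e. e \<in> arcs G \<Longrightarrow> u e (len e) = \<nu> (head G e)"
    using continuous_at_vertices_imp_vertex_function[OF vert] by blast
  \<comment> \<open>The Kirchhoff condition tested with a vertex function: \<open>f = 1\<close>
    yields mean zero, and \<open>f = \<nu>\<close> removes the boundary terms of the energy
    identity.\<close>
  have flux: "(\<Sum>e\<in>arcs G. f (head G e) * \<psi> e (len e) - f (tail G e) * \<psi> e 0) = 0" for f :: "'v \<Rightarrow> real"
  proof -
    have "(\<Sum>e\<in>arcs G. f (head G e) * \<psi> e (len e) - f (tail G e) * \<psi> e 0)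
        = (\<Sum>v\<in>verts G. f v * (\<Sum>e\<in>incident_edges G v. if v = head G e then \<psi> e (len e) else - \<psi> e 0))"
      unfolding sum_verts_incident by simp
    also have "\<dots> = (\<Sum>v\<in>verts G. f v * (\<Sum>e\<in>incident_edges G v. normal_deriv G len u e v))"
    proof (intro sum.cong arg_cong2[where f = "(*)"])
      fix v e assume "e \<in> incident_edges G v"
      then have e: "e \<in> arcs G" by (simp add: incident_edges_def)
      show "(if v = head G e then \<psi> e (len e) else - \<psi> e 0) = normal_deriv G len u e v"
        using deriv_one_sided_limits[OF len_pos[OF e] \<psi>c[OF e] \<psi>(1)[OF e]]
        by (simp add: normal_deriv_def)
    qed auto
    also have "\<dots> = 0" by (simp add: kirchhoff)
    finally show ?thesis .
  qed
  let ?S = "\<Sum>e\<in>arcs G. integral {0..len e} (\<lambda>x. (u e x)\<^sup>2)"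
  let ?E = "\<Sum>e\<in>arcs G. integral {0..len e} (\<lambda>x. (\<psi> e x)\<^sup>2)"
  have "integral {0..len e} (\<lambda>x. - \<mu> * u e x) = \<psi> e (len e) - \<psi> e 0" if e: "e \<in> arcs G" for e
    by (intro integral_unique fundamental_theorem_of_calculus)
      (use \<psi>(2)[OF e] len_pos[OF e] in \<open>auto simp: has_real_derivative_iff_has_vector_derivative\<close>)
  then have "- \<mu> * (\<Sum>e\<in>arcs G. integral {0..len e} (u e)) = (\<Sum>e\<in>arcs G. \<psi> e (len e) - \<psi> e 0)"
    by (simp add: sum_distrib_left)
  also have "\<dots> = 0" using flux[of "\<lambda>v. 1"] by simp
  \<comment> \<open>Dividing by \<open>\<mu>\<close> is where \<open>\<mu> \<noteq> 0\<close>
    enters; nonzero constants are eigenfunctions for 0 whose mean is not zero.\<close>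
  finally have mean: "(\<Sum>e\<in>arcs G. integral {0..len e} (u e)) = 0" using assms(2) by simp
  have "integral {0..len e} (\<lambda>x. (\<psi> e x)\<^sup>2) - \<mu> * integral {0..len e} (\<lambda>x. (u e x)\<^sup>2)
      = \<nu> (head G e) * \<psi> e (len e) - \<nu> (tail G e) * \<psi> e 0" if e: "e \<in> arcs G" for e
  proof -
    have "((\<lambda>x. (\<psi> e x)\<^sup>2 - \<mu> * (u e x)\<^sup>2) has_integral
        u e (len e) * \<psi> e (len e) - u e 0 * \<psi> e 0) {0..len e}"
    proof (rule fundamental_theorem_of_calculus)
      fix x assume x: "x \<in> {0..len e}"
      have "((\<lambda>x. u e x * \<psi> e x) has_real_derivative (\<psi> e x)\<^sup>2 - \<mu> * (u e x)\<^sup>2) (at x within {0..len e})"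
        using DERIV_mult[OF \<psi>(1)[OF e x] \<psi>(2)[OF e x]]
        by (simp add: power2_eq_square algebra_simps)
      then show "((\<lambda>x. u e x * \<psi> e x) has_vector_derivative (\<psi> e x)\<^sup>2 - \<mu> * (u e x)\<^sup>2)
          (at x within {0..len e})"
        by (simp add: has_real_derivative_iff_has_vector_derivative)
    qed (use len_pos[OF e] in simp)
    moreover have "((\<lambda>x. (\<psi> e x)\<^sup>2 - \<mu> * (u e x)\<^sup>2) has_integral
        integral {0..len e} (\<lambda>x. (\<psi> e x)\<^sup>2) - \<mu> * integral {0..len e} (\<lambda>x. (u e x)\<^sup>2)) {0..len e}"
      by (intro has_integral_diff has_integral_mult_right integrable_integral integrable_continuous_real
          continuous_on_power \<psi>c u e)
    ultimately show ?thesis using \<nu>[OF e] by (simp add: has_integral_unique)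
  qed
  then have "?E - \<mu> * ?S = (\<Sum>e\<in>arcs G. \<nu> (head G e) * \<psi> e (len e) - \<nu> (tail G e) * \<psi> e 0)"
    by (simp add: sum_distrib_left sum_subtractf[symmetric])
  then have E: "?E = \<mu> * ?S" unfolding flux by simp
  have "h\<^sup>2 * ?S \<le> 4 * ?E"
  proof (rule cheeger_inequality_energy[OF u vert _ _ mean h])
    show "(\<psi> e has_integral u e b - u e a) {a..b}"
      if e: "e \<in> arcs G" and ab: "0 \<le> a" "a \<le> b" "b \<le> len e" for e a b
    proof (rule fundamental_theorem_of_calculus[OF ab(2)])
      fix x assume x: "x \<in> {a..b}"
      have "(u e has_real_derivative \<psi> e x) (at x within {a..b})"
        by (rule DERIV_subset[OF \<psi>(1)[OF e]]) (use x ab in auto)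
      then show "(u e has_vector_derivative \<psi> e x) (at x within {a..b})"
        by (simp add: has_real_derivative_iff_has_vector_derivative)
    qed
    show "(\<lambda>x. (\<psi> e x)\<^sup>2) integrable_on {0..len e}" if "e \<in> arcs G" for e
      by (intro integrable_continuous_real continuous_on_power \<psi>c that)
  qed
  moreover have "0 < ?S" using norm by (simp flip: L2_norm_square[OF u])
  ultimately show "h\<^sup>2 \<le> 4 * \<mu>" by (simp add: E)
qed

end

theorem theorem5p7:
  fixes G :: "('v, 'e) pre_digraph" and len :: "'e \<Rightarrow> real"
  assumes "compact_metric_graph G len"
  shows "ereal (1/4) * (cheeger_constant G len)\<^sup>2 \<le> spectral_gap G len
    \<and> (\<forall>\<mu>. neg_laplacian_eigenvalue G len \<mu> \<and> \<mu> \<noteq> 0 \<longrightarrow>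
          ereal (1/4) * (cheeger_constant G len)\<^sup>2 \<le> ereal \<mu>)"
  using compact_metric_graph.cheeger_le_spectral_gap[OF assms]
    compact_metric_graph.cheeger_le_eigenvalue[OF assms] by blast

end
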